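(* Let $G$ be a non-compact, compactly generated, totally disconnected, locally compact group, and let $H\le\mathbb{Q}^{+}$ be the image of its modular function. Let $$A=\Big\{\sum_{i=1}^k (p_i+q_i)\ \Big|\ k\ge 1,\ p_1,\dots,p_k,q_1,\dots,q_k \text{ positive integers},\ \Big\langle \tfrac{p_1}{q_1},\dots,\tfrac{p_k}{q_k}\Big\rangle = H\Big\}.$$ Then every Cayley–Abels graph of $G$ has degree at least $\min(A)$. In particular, if $H$ is cyclic, generated by $p/q$ with $p,q$ coprime positive integers, then every Cayley–Abels graph of $G$ has degree at least $p+q$, i.e. $\mathrm{md}(G)\ge p+q$.
   Context: A Cayley–Abels graph for a totally disconnected, locally compact group $G$ is a connected, locally finite simple graph with an action of $G$ by automorphisms that is vertex-transitive with compact open vertex stabilizers; $\mathrm{md}(G)$ is the minimal degree of such a graph. The modular function $\Delta\colon G\to\mathbb{R}^+$ is defined via a right-invariant Haar measure $\mu$ by $\mu(gA)=\Delta(g)\mu(A)$; its image is a subgroup of the multiplicative group $\mathbb{Q}^+$ of positive rationals. *)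

theory Defs
  imports "HOL-Analysis.Analysis" "HOL-Probability.Probability"
begin

text \<open>Topological groups are modelled by the type class topological_group_add:
  a (not necessarily commutative) group written additively, with jointly continuous
  group operation and continuous inversion. Group product g h is written g + h.\<close>

definition totally_disconnected_space :: "'a::topological_space itself \<Rightarrow> bool" where
  "totally_disconnected_space _ \<longleftrightarrow> (\<forall>x::'a. connected_component_set UNIV x = {x})"

definition locally_compact_type :: "'a::topological_space itself \<Rightarrow> bool" where
  "locally_compact_type _ \<longleftrightarrow>
     (\<forall>x::'a. \<exists>U K. open U \<and> compact K \<and> x \<in> U \<and> U \<subseteq> K)"

inductive_set subgroup_generated :: "'a::group_add set \<Rightarrow> 'a set" for S where
  sg_gen: "x \<in> S \<Longrightarrow> x \<in> subgroup_generated S"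
| sg_zero: "0 \<in> subgroup_generated S"
| sg_add: "x \<in> subgroup_generated S \<Longrightarrow> y \<in> subgroup_generated S \<Longrightarrow> x + y \<in> subgroup_generated S"
| sg_uminus: "x \<in> subgroup_generated S \<Longrightarrow> - x \<in> subgroup_generated S"

definition compactly_generated :: "'a::{topological_space,group_add} itself \<Rightarrow> bool" where
  "compactly_generated _ \<longleftrightarrow> (\<exists>K::'a set. compact K \<and> subgroup_generated K = UNIV)"

text \<open>Right-invariant Haar measure: a nonzero right-invariant Radon measure on the Borel sets
  (finite on compacts, positive on nonempty open sets, outer regular on Borel sets,
  inner regular on open sets).\<close>

definition right_haar :: "'a::{topological_group_add} measure \<Rightarrow> bool" where
  "right_haar M \<longleftrightarrow>
     sets M = sets borel \<and>
     (\<forall>A\<in>sets borel. \<forall>g. emeasure M ((\<lambda>x. x + g) ` A) = emeasure M A) \<and>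
     (\<forall>K. compact K \<longrightarrow> emeasure M K < \<infinity>) \<and>
     (\<forall>U. open U \<and> U \<noteq> {} \<longrightarrow> emeasure M U > 0) \<and>
     (\<forall>A\<in>sets borel. emeasure M A = (INF U\<in>{U. open U \<and> A \<subseteq> U}. emeasure M U)) \<and>
     (\<forall>U. open U \<longrightarrow> emeasure M U = (SUP K\<in>{K. compact K \<and> K \<subseteq> U}. emeasure M K))"

text \<open>Modular function: mu(gA) = Delta(g) mu(A) for a (fixed) right Haar measure mu.\<close>

definition modular_function :: "'a::{topological_group_add} \<Rightarrow> real" where
  "modular_function g = (THE r. r > 0 \<and>
     (\<forall>A\<in>sets borel. emeasure (SOME M. right_haar M) ((\<lambda>x. g + x) ` A)
                      = ennreal r * emeasure (SOME M. right_haar M) A))"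

text \<open>Subgroup of the multiplicative group of positive reals generated by a set.\<close>

inductive_set mult_subgroup_generated :: "real set \<Rightarrow> real set" for S where
  msg_gen: "x \<in> S \<Longrightarrow> x \<in> mult_subgroup_generated S"
| msg_one: "1 \<in> mult_subgroup_generated S"
| msg_mult: "x \<in> mult_subgroup_generated S \<Longrightarrow> y \<in> mult_subgroup_generated S \<Longrightarrow> x * y \<in> mult_subgroup_generated S"
| msg_inv: "x \<in> mult_subgroup_generated S \<Longrightarrow> inverse x \<in> mult_subgroup_generated S"

text \<open>Cayley--Abels graph for G (vertex set = the type 'v): simple, connected, locally finite
  graph with a G-action by automorphisms which is vertex-transitive with compact open
  vertex stabilizers.\<close>

definition cayley_abels_graph ::
  "('g::{topological_group_add} \<Rightarrow> 'v \<Rightarrow> 'v) \<Rightarrow> ('v \<Rightarrow> 'v \<Rightarrow> bool) \<Rightarrow> bool" where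
  "cayley_abels_graph act E \<longleftrightarrow>
     (\<forall>v. \<not> E v v) \<and> (\<forall>u v. E u v \<longrightarrow> E v u) \<and>
     (\<forall>u v. (u, v) \<in> {(x, y). E x y}\<^sup>*) \<and>
     (\<forall>v. finite {w. E v w}) \<and>
     (\<forall>v. act 0 v = v) \<and> (\<forall>g h v. act (g + h) v = act g (act h v)) \<and>
     (\<forall>g u v. E (act g u) (act g v) \<longleftrightarrow> E u v) \<and>
     (\<forall>u v. \<exists>g. act g u = v) \<and>
     (\<forall>v. compact {g. act g v = v} \<and> open {g. act g v = v})"

end

theory Submission
  imports Defs
begin

text \<open>
  Fix a vertex \<open>v\<close> with stabiliser \<open>V\<close>. For \<open>u = g v\<close> the numbers \<open>|V : V \<inter> gVg\<^sup>-\<^sup>1|\<close> and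
  \<open>|gVg\<^sup>-\<^sup>1 : V \<inter> gVg\<^sup>-\<^sup>1|\<close> are the sizes of the \<open>V\<close>-orbits of \<open>g v\<close> and \<open>g\<^sup>-\<^sup>1 v\<close>, so the modular
  function at \<open>g\<close> is the quotient of the sizes of two paired suborbits. By connectedness the group is
  generated by \<open>V\<close>, on which the modular function is 1, and the \<open>g\<close> moving \<open>v\<close> to a neighbour; hence
  the image of the modular function is generated by the quotients for the paired orbits of \<open>V\<close> on the
  neighbours of \<open>v\<close>. Discarding the pairs of orbits of equal size, the remaining orbits are
  disjoint and their sizes add up to at most the degree. If all pairs are discarded the image is
  trivial, and the degree is at least 2 because the group is not compact.

  The modular function is defined through a choice of Haar measure, so one has to be constructed:
  small open subgroups exist by van Dantzig's theorem, the normalised number of right cosets of a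
  shrinking open subgroup that meet a compact set converges to a content, and the content induces
  a Radon measure.
\<close>

section \<open>Open subgroups and van Dantzig's theorem\<close>

definition open_subgroup :: "'a::topological_group_add set \<Rightarrow> bool" where
  "open_subgroup W \<longleftrightarrow> open W \<and> 0 \<in> W \<and> (\<forall>x\<in>W. \<forall>y\<in>W. x + y \<in> W) \<and> (\<forall>x\<in>W. - x \<in> W)"

text \<open>Right cosets are the suitable ones here: right translations permute them, so a
  right-invariant measure gives all cosets of an open subgroup \<open>W\<close> the same
  mass.\<close>

definition rcos :: "'a::group_add set \<Rightarrow> 'a \<Rightarrow> 'a set" where
  "rcos W x = (\<lambda>w. w + x) ` W"

lemma mem_rcos_iff: "y \<in> rcos W x \<longleftrightarrow> y - x \<in> W"
  by (force simp: rcos_def image_iff diff_eq_eq)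

lemma open_subgroup_Int: "open_subgroup W \<Longrightarrow> open_subgroup W' \<Longrightarrow> open_subgroup (W \<inter> W')"
  by (auto simp: open_subgroup_def)

lemma open_subgroup_diff: "open_subgroup W \<Longrightarrow> x \<in> W \<Longrightarrow> y \<in> W \<Longrightarrow> x - y \<in> W"
  unfolding open_subgroup_def by (metis add_uminus_conv_diff)

lemma open_subgroup_diff_commute: "open_subgroup W \<Longrightarrow> x - y \<in> W \<longleftrightarrow> y - x \<in> W"
  unfolding open_subgroup_def by (metis minus_diff_eq)

lemma open_subgroup_diff_trans:
  assumes "open_subgroup W" "x - y \<in> W" "y - z \<in> W" shows "x - z \<in> W"
proof -
  have "x - z = (x - y) + (y - z)" by (simp add: algebra_simps)
  then show ?thesis using assms by (metis open_subgroup_def)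
qed

lemma self_mem_rcos: "open_subgroup W \<Longrightarrow> x \<in> rcos W x"
  by (simp add: mem_rcos_iff open_subgroup_def)

lemma rcos_eq_iff:
  assumes "open_subgroup W" shows "rcos W x = rcos W y \<longleftrightarrow> x - y \<in> W"
  using open_subgroup_diff_trans[OF assms] open_subgroup_diff_commute[OF assms] self_mem_rcos[OF assms]
  by (auto simp: set_eq_iff mem_rcos_iff)

lemma rcos_eqI: "open_subgroup W \<Longrightarrow> z \<in> rcos W x \<Longrightarrow> rcos W x = rcos W z"
  by (metis mem_rcos_iff rcos_eq_iff)

lemma rcos_mono: "W \<subseteq> W' \<Longrightarrow> rcos W x \<subseteq> rcos W' x"
  by (auto simp: rcos_def)

lemma rcos_subset_trans:
  assumes "open_subgroup W" "y \<in> rcos W x" "W' \<subseteq> W" shows "rcos W' y \<subseteq> rcos W x"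
  by (metis assms mem_rcos_iff rcos_eq_iff rcos_mono)

lemma image_add_right_rcos: "(\<lambda>x. x + g) ` rcos W x = rcos W (x + g)"
  by (auto simp: rcos_def image_image add.assoc)

section \<open>Translations, and topological properties of cosets\<close>

lemma continuous_on_add_right: "continuous_on S (\<lambda>x::'a::topological_group_add. x + a)"
  by (intro continuous_intros)

lemma continuous_on_add_left: "continuous_on S (\<lambda>x::'a::topological_group_add. a + x)"
  by (intro continuous_intros)

lemma image_add_right_eq_vimage: "(\<lambda>x::'a::group_add. x + a) ` S = (\<lambda>x. x + - a) -` S"
  by (force simp: image_iff)

lemma image_add_left_eq_vimage: "(\<lambda>x::'a::group_add. a + x) ` S = (\<lambda>x. - a + x) -` S"
  by (auto simp: image_iff) (metis add_minus_cancel)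

lemma open_image_add_right: "open S \<Longrightarrow> open ((\<lambda>x::'a::topological_group_add. x + a) ` S)"
  unfolding image_add_right_eq_vimage by (rule open_vimage[OF _ continuous_on_add_right])

lemma open_image_add_left: "open S \<Longrightarrow> open ((\<lambda>x::'a::topological_group_add. a + x) ` S)"
  unfolding image_add_left_eq_vimage by (rule open_vimage[OF _ continuous_on_add_left])

lemma open_rcos: "open W \<Longrightarrow> open (rcos W (x::'a::topological_group_add))"
  unfolding rcos_def by (rule open_image_add_right)

lemma compact_rcos: "compact W \<Longrightarrow> compact (rcos W (x::'a::topological_group_add))"
  unfolding rcos_def by (rule compact_continuous_image[OF continuous_on_add_right])

lemma closed_open_subgroup:
  assumes "open_subgroup W" shows "closed W"
proof -
  have "- W = (\<Union>x\<in>-W. rcos W x)"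
    using assms by (auto simp: mem_rcos_iff open_subgroup_def)
      (metis diff_add_cancel minus_diff_eq)
  then show ?thesis
    by (metis assms closed_def open_UN open_rcos open_subgroup_def)
qed

text \<open>The cosets of \<open>W\<close> are open and partition the group, so a finite subcover of
  \<open>K\<close> already contains every coset that meets \<open>K\<close>.\<close>

lemma compact_imp_finite_rcos:
  assumes "open_subgroup W" "compact K" shows "finite (rcos W ` K)"
proof -
  have "K \<subseteq> (\<Union>x\<in>K. rcos W x)" using self_mem_rcos[OF assms(1)] by auto
  moreover have "\<forall>x\<in>K. open (rcos W x)" using assms by (simp add: open_rcos open_subgroup_def)
  ultimately obtain F where F: "F \<subseteq> K" "finite F" "K \<subseteq> (\<Union>x\<in>F. rcos W x)"
    using assms(2) by (metis compactE_image)
  then have "rcos W ` K \<subseteq> rcos W ` F"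
    using rcos_eq_iff[OF assms(1)] by (fastforce simp: mem_rcos_iff)
  then show ?thesis using F by (meson finite_imageI finite_subset)
qed

text \<open>A tube argument: continuity of addition at \<open>(k, 0)\<close> gives a product
  neighbourhood \<open>A k \<times> B k\<close> for each \<open>k\<close>. Finitely many
  \<open>A k\<close> cover \<open>K\<close>, and the intersection of the corresponding
  \<open>B k\<close> serves all of \<open>K\<close> at once.\<close>

lemma compact_add_nhd_subset:
  fixes K :: "'a::topological_group_add set"
  assumes "compact K" "open U" "K \<subseteq> U"
  shows "\<exists>N. open N \<and> 0 \<in> N \<and> (\<forall>k\<in>K. \<forall>n\<in>N. k + n \<in> U)"
proof -
  have cont: "continuous_on UNIV (\<lambda>z. fst z + snd z :: 'a)" by (intro continuous_intros)
  have "\<exists>A B. open A \<and> open B \<and> k \<in> A \<and> 0 \<in> B \<and> (\<forall>a\<in>A. \<forall>b\<in>B. a + b \<in> U)" if "k \<in> K" for k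
  proof -
    have "open ((\<lambda>z. fst z + snd z) -` U)" by (rule open_vimage[OF assms(2) cont])
    moreover have "(k, 0) \<in> (\<lambda>z. fst z + snd z) -` U" using that assms by auto
    ultimately obtain A B where "open A" "open B" "(k, 0) \<in> A \<times> B" "A \<times> B \<subseteq> (\<lambda>z. fst z + snd z) -` U"
      by (rule open_prod_elim)
    then show ?thesis by (intro exI[of _ A] exI[of _ B]) force
  qed
  then obtain A B where AB: "\<And>k. k \<in> K \<Longrightarrow> open (A k) \<and> open (B k) \<and> k \<in> A k \<and> 0 \<in> B k \<and> (\<forall>a\<in>A k. \<forall>b\<in>B k. a + b \<in> U)"
    by metis
  then have "K \<subseteq> (\<Union>k\<in>K. A k)" "\<forall>k\<in>K. open (A k)" by auto
  then obtain F where F: "F \<subseteq> K" "finite F" "K \<subseteq> (\<Union>k\<in>F. A k)"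
    using assms(1) by (metis compactE_image)
  show ?thesis
    by (rule exI[of _ "\<Inter>k\<in>F. B k"]) (use F AB in \<open>auto; blast\<close>)
qed

text \<open>\<open>V\<close> is a compact open reference subgroup: smaller subgroups are sought
  inside it, and it normalises the coset counts below. In the application it is a vertex
  stabiliser.\<close>

locale td_group =
  fixes V :: "'g::{topological_group_add, t2_space} set"
  assumes td: "totally_disconnected_space TYPE('g)"
    and V: "open_subgroup V" and compact_V: "compact V"
begin

text \<open>In the compact Hausdorff space \<open>V\<close> a connected set through 0 is just
  \<open>{0}\<close>, so the cut wire fence theorem separates 0 from \<open>V - U\<close> by a
  clopen set. As \<open>V\<close> is open and compact, a clopen subset of it is open and compact in
  the whole group.\<close>

lemma small_clopen:
  assumes "open U" "0 \<in> U"
  obtains C where "compact C" "open C" "0 \<in> C" "C \<subseteq> U \<inter> V"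
proof -
  let ?X = "top_of_set V"
  have oV: "open V" "0 \<in> V" using V by (auto simp: open_subgroup_def)
  have "separated_between ?X {0} (V - U)"
  proof (rule cut_wire_fence_theorem)
    show "compact_space ?X" using compact_V by (simp add: compact_space_subtopology)
    show "Hausdorff_space ?X" by (rule Hausdorff_space_subtopology) (simp add: Hausdorff_space_def disjnt_def, metis hausdorff)
    show "closedin ?X {0}" using oV by (simp add: closed_subset)
    show "closedin ?X (V - U)"
      by (metis Diff_eq assms(1) closed_Compl closedin_closed_Int)
    fix C assume "connectedin ?X C"
    then have C: "connected C" by (simp add: connectedin_subtopology)
    show "disjnt C {0} \<or> disjnt C (V - U)"
    proof (cases "0 \<in> C")
      case True
      then have "C \<subseteq> connected_component_set UNIV 0"
        by (simp add: C connected_component_maximal)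
      then have "C \<subseteq> {0}" using td by (simp add: totally_disconnected_space_def)
      then show ?thesis using assms by (auto simp: disjnt_def)
    qed (simp add: disjnt_def)
  qed
  then obtain C where C: "closedin ?X C" "openin ?X C" "{0} \<subseteq> C" "V - U \<subseteq> V - C"
    unfolding separated_between by auto
  show thesis
  proof
    show "compact C" using C(1) compact_V closedin_compact by blast
    show "open C" using C(2) oV openin_open_eq by blast
    show "0 \<in> C" using C by auto
    show "C \<subseteq> U \<inter> V" using C closedin_subset[OF C(1)] by auto
  qed
qed

text \<open>Van Dantzig's theorem: the stabiliser of a compact open neighbourhood of 0 under right
  translation is an open subgroup contained in that neighbourhood.\<close>

lemma small_open_subgroup:
  assumes "open U" "0 \<in> U"
  obtains W where "open_subgroup W" "W \<subseteq> U" "W \<subseteq> V"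
proof -
  obtain C where C: "compact C" "open C" "0 \<in> C" "C \<subseteq> U \<inter> V" using small_clopen[OF assms] .
  define W where "W = {x. \<forall>c. c + x \<in> C \<longleftrightarrow> c \<in> C}"
  obtain N where N: "open N" "0 \<in> N" "\<forall>k\<in>C. \<forall>n\<in>N. k + n \<in> C"
    using compact_add_nhd_subset[OF C(1,2)] by auto
  \<comment> \<open>A symmetric neighbourhood is needed because membership in \<open>W\<close> is an
    equivalence: adding \<open>n\<close> keeps points of \<open>C\<close> in \<open>C\<close>, and
    adding \<open>- n\<close> brings them back.\<close>
  let ?N = "N \<inter> uminus -` N"
  have oN: "open ?N" by (intro open_Int N open_vimage continuous_intros)
  have NW: "?N \<subseteq> W"
  proof
    fix n assume n: "n \<in> ?N"
    have "c \<in> C" if "c + n \<in> C" for c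
    proof -
      have "(c + n) + (- n) \<in> C" using N(3) n that by blast
      then show ?thesis by (simp add: add.assoc)
    qed
    moreover have "c + n \<in> C" if "c \<in> C" for c using N(3) n that by blast
    ultimately have "c + n \<in> C \<longleftrightarrow> c \<in> C" for c by (rule iffI)
    then show "n \<in> W" unfolding W_def by (intro CollectI allI)
  qed
  have add: "x + y \<in> W" if "x \<in> W" "y \<in> W" for x y
    using that by (simp add: W_def flip: add.assoc)
  have "- x \<in> W" if "x \<in> W" for x
  proof -
    have "c + - x \<in> C \<longleftrightarrow> c \<in> C" for c
      using that[unfolded W_def, simplified, rule_format, of "c + - x"] by (simp add: add.assoc)
    then show ?thesis by (simp add: W_def)
  qed
  moreover have "open W"
  proof (subst open_subopen, intro ballI)
    fix x assume x: "x \<in> W"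
    show "\<exists>T. open T \<and> x \<in> T \<and> T \<subseteq> W"
    proof (intro exI conjI)
      show "open ((\<lambda>y. x + y) ` ?N)" by (rule open_image_add_left[OF oN])
      show "x \<in> (\<lambda>y. x + y) ` ?N" using N(2) by (intro image_eqI[of _ _ 0]) auto
      show "(\<lambda>y. x + y) ` ?N \<subseteq> W" using NW add x by blast
    qed
  qed
  ultimately have "open_subgroup W" using add by (auto simp: open_subgroup_def W_def)
  moreover have "W \<subseteq> C"
  proof
    fix x assume "x \<in> W"
    then have "0 + x \<in> C" using C(3) unfolding W_def by blast
    then show "x \<in> C" by simp
  qed
  ultimately show thesis using C that by blast
qed

text \<open>A Lebesgue number lemma with subgroups as radii. Finitely many cosets
  \<open>rcos (W x) x\<close>, each inside a member of the cover, cover \<open>K\<close>. For a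
  subgroup below all these \<open>W x\<close>, a coset through a point of
  \<open>rcos (W x) x\<close> stays inside that coset.\<close>

lemma lebesgue_subgroup:
  assumes "compact K" "\<And>U. U \<in> \<U> \<Longrightarrow> open U" "K \<subseteq> \<Union>\<U>"
  obtains W where "open_subgroup W" "W \<subseteq> V" "\<And>x. x \<in> K \<Longrightarrow> \<exists>U\<in>\<U>. rcos W x \<subseteq> U"
proof -
  have "\<exists>W. open_subgroup W \<and> W \<subseteq> V \<and> (\<exists>U\<in>\<U>. rcos W x \<subseteq> U)" if x: "x \<in> K" for x
  proof -
    obtain U where U: "U \<in> \<U>" "x \<in> U" using subsetD[OF assms(3) x] by (rule UnionE)
    have "open ((\<lambda>y. y + x) -` U)" "0 \<in> (\<lambda>y. y + x) -` U"
      using assms(2) U by (auto intro!: open_vimage continuous_on_add_right)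
    then obtain W where "open_subgroup W" "W \<subseteq> (\<lambda>y. y + x) -` U" "W \<subseteq> V"
      using small_open_subgroup by metis
    then show ?thesis using U by (auto simp: rcos_def)
  qed
  then obtain W where W: "\<And>x. x \<in> K \<Longrightarrow> open_subgroup (W x) \<and> W x \<subseteq> V \<and> (\<exists>U\<in>\<U>. rcos (W x) x \<subseteq> U)"
    by metis
  have op: "\<And>x. x \<in> K \<Longrightarrow> open (rcos (W x) x)"
    using W by (simp add: open_rcos open_subgroup_def)
  have cov: "K \<subseteq> (\<Union>x\<in>K. rcos (W x) x)"
    using W self_mem_rcos by blast
  obtain F where F: "F \<subseteq> K" "finite F" "K \<subseteq> (\<Union>x\<in>F. rcos (W x) x)"
    by (rule compactE_image[OF assms(1) op cov])
  \<comment> \<open>The factor \<open>V\<close> keeps the intersection inside \<open>V\<close> also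
    when \<open>F\<close> is empty.\<close>
  let ?W = "V \<inter> (\<Inter>x\<in>F. W x)"
  show thesis
  proof
    have "finite F' \<Longrightarrow> F' \<subseteq> K \<Longrightarrow> open_subgroup (V \<inter> (\<Inter>x\<in>F'. W x))" for F'
    proof (induction F' rule: finite_induct)
      case (insert a F')
      then have "open_subgroup (W a \<inter> (V \<inter> (\<Inter>x\<in>F'. W x)))"
        using W by (auto intro!: open_subgroup_Int)
      then show ?case by (simp add: Int_left_commute Int_commute Int_assoc)
    qed (use V in auto)
    then show "open_subgroup ?W" using F by blast
    fix y assume "y \<in> K"
    then obtain x where x: "x \<in> F" "y \<in> rcos (W x) x" using F by auto
    then obtain U where "U \<in> \<U>" "rcos (W x) x \<subseteq> U" using W F by blast
    moreover have "rcos ?W y \<subseteq> rcos (W x) x"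
      using x F W by (intro rcos_subset_trans) auto
    ultimately show "\<exists>U\<in>\<U>. rcos ?W y \<subseteq> U" by blast
  qed auto
qed

end

section \<open>Radon measures from contents\<close>

text \<open>Additivity on disjoint compact sets is required only as the inequality
  \<open>l_add\<close>; the converse is \<open>l_subadd\<close>. A content extends to open sets from
  inside, and from these to all sets from outside.\<close>

locale compact_content =
  fixes l :: "'a::t2_space set \<Rightarrow> ennreal"
  assumes l_mono: "compact K \<Longrightarrow> compact L \<Longrightarrow> K \<subseteq> L \<Longrightarrow> l K \<le> l L"
    and l_empty: "l {} = 0"
    and l_subadd: "compact K \<Longrightarrow> compact L \<Longrightarrow> l (K \<union> L) \<le> l K + l L"
    and l_add: "compact K \<Longrightarrow> compact L \<Longrightarrow> K \<inter> L = {} \<Longrightarrow> l K + l L \<le> l (K \<union> L)"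
begin

definition inner_content :: "'a set \<Rightarrow> ennreal" where
  "inner_content U = (SUP K\<in>{K. compact K \<and> K \<subseteq> U}. l K)"

definition outer_content :: "'a set \<Rightarrow> ennreal" where
  "outer_content A = (INF U\<in>{U. open U \<and> A \<subseteq> U}. inner_content U)"

lemma inner_mono: "U \<subseteq> U' \<Longrightarrow> inner_content U \<le> inner_content U'"
  unfolding inner_content_def by (rule SUP_subset_mono) auto

lemma l_le_inner: "compact K \<Longrightarrow> K \<subseteq> U \<Longrightarrow> l K \<le> inner_content U"
  unfolding inner_content_def by (rule SUP_upper) auto

lemma inner_empty: "inner_content {} = 0"
  unfolding inner_content_def by (auto simp: l_empty intro!: antisym SUP_least)

lemma outer_mono: "A \<subseteq> B \<Longrightarrow> outer_content A \<le> outer_content B"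
  unfolding outer_content_def by (rule INF_superset_mono) auto

lemma outer_open: "open U \<Longrightarrow> outer_content U = inner_content U"
  unfolding outer_content_def by (auto intro!: antisym INF_lower INF_greatest inner_mono)

lemma outer_le_inner: "open U \<Longrightarrow> A \<subseteq> U \<Longrightarrow> outer_content A \<le> inner_content U"
  unfolding outer_content_def by (rule INF_lower) auto

text \<open>The compact sets \<open>K - U1\<close> and \<open>K - U2\<close> are disjoint, hence
  have disjoint open neighbourhoods. Removing one neighbourhood at a time from \<open>K\<close>
  leaves the two pieces.\<close>

lemma compact_split:
  assumes "compact K" "open U1" "open U2" "K \<subseteq> U1 \<union> U2"
  obtains K1 K2 where "compact K1" "compact K2" "K = K1 \<union> K2" "K1 \<subseteq> U1" "K2 \<subseteq> (U2::'a set)"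
proof -
  have "compact (K - U1)" "compact (K - U2)" using assms by (auto intro: compact_diff)
  moreover have "Hausdorff_space (euclidean :: 'a topology)"
    by (simp add: Hausdorff_space_def disjnt_def) (metis hausdorff)
  moreover have "disjnt (K - U1) (K - U2)" using assms by (auto simp: disjnt_def)
  ultimately obtain V1 V2 where V: "open V1" "open V2" "K - U1 \<subseteq> V1" "K - U2 \<subseteq> V2" "disjnt V1 V2"
    unfolding Hausdorff_space_compact_sets by (metis compactin_euclidean_iff open_openin)
  show thesis
  proof
    show "compact (K - V1)" "compact (K - V2)" using assms V by (auto intro: compact_diff)
    show "K = (K - V1) \<union> (K - V2)" using V by (auto simp: disjnt_iff)
    show "K - V1 \<subseteq> U1" "K - V2 \<subseteq> U2" using V by auto
  qed
qed

lemma l_le_sum_inner: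
  "compact K \<Longrightarrow> (\<And>i. open (U i)) \<Longrightarrow> K \<subseteq> (\<Union>i<n. U i) \<Longrightarrow> l K \<le> (\<Sum>i<n. inner_content (U i))" for n :: nat
proof (induction n arbitrary: K)
  case 0 then show ?case by (simp add: l_empty)
next
  case (Suc n)
  have "K \<subseteq> (\<Union>i<n. U i) \<union> U n" using Suc.prems(3) by (simp add: lessThan_Suc Un_commute)
  then obtain K1 K2 where K: "compact K1" "compact K2" "K = K1 \<union> K2" "K1 \<subseteq> (\<Union>i<n. U i)" "K2 \<subseteq> U n"
    by (rule compact_split[OF Suc.prems(1), rotated 2]) (simp_all add: Suc.prems(2) open_UN)
  have "l K \<le> l K1 + l K2" using K l_subadd by simp
  also have "\<dots> \<le> (\<Sum>i<n. inner_content (U i)) + inner_content (U n)"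
    using K Suc.IH[OF _ Suc.prems(2)] by (intro add_mono l_le_inner) auto
  finally show ?case by simp
qed

lemma inner_UN_le:
  assumes "\<And>i::nat. open (U i)" shows "inner_content (\<Union>i. U i) \<le> (\<Sum>i. inner_content (U i))"
  unfolding inner_content_def[of "\<Union>i. U i"]
proof (rule SUP_least)
  fix K assume "K \<in> {K. compact K \<and> K \<subseteq> (\<Union>i. U i)}"
  then have K: "compact K" "K \<subseteq> (\<Union>i\<in>UNIV. U i)" by auto
  obtain I where I: "I \<subseteq> UNIV" "finite I" "K \<subseteq> (\<Union>i\<in>I. U i)"
    by (rule compactE_image[OF K(1) assms K(2)])
  obtain n where "I \<subseteq> {..<n}" using I(2) finite_nat_bounded by blast
  then have "K \<subseteq> (\<Union>i<n. U i)" using I by blast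
  then have "l K \<le> (\<Sum>i<n. inner_content (U i))" by (rule l_le_sum_inner[OF K(1) assms])
  also have "\<dots> \<le> (\<Sum>i. inner_content (U i))" by (intro sum_le_suminf) auto
  finally show "l K \<le> (\<Sum>i. inner_content (U i))" .
qed

lemma outer_UN_le: "outer_content (\<Union>i. A i) \<le> (\<Sum>i. outer_content (A i))" for A :: "nat \<Rightarrow> 'a set"
proof (rule ennreal_le_epsilon)
  fix e :: real assume e: "0 < e" "(\<Sum>n. outer_content (A n)) < top"
  \<comment> \<open>Finiteness of the sum makes each term finite, so the enlarged bound is strictly
    larger and the infimum supplies an open witness. The errors add up to \<open>e\<close>.\<close>
  then have *: "outer_content (A n) < outer_content (A n) + e * (1/2)^Suc n" for n
    by (auto simp add: less_top dest!: ennreal_suminf_lessD)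
  have "\<exists>U. open U \<and> A n \<subseteq> U \<and> inner_content U \<le> outer_content (A n) + e * (1/2)^Suc n" for n
    using *[of n] unfolding outer_content_def[of "A n"] INF_less_iff by (auto intro: less_imp_le)
  then obtain U where U: "\<And>n. open (U n)" "\<And>n. A n \<subseteq> U n"
      "\<And>n. inner_content (U n) \<le> outer_content (A n) + e * (1/2)^Suc n"
    by metis
  have "outer_content (\<Union>i. A i) \<le> inner_content (\<Union>i. U i)" using U by (intro outer_le_inner) auto
  also have "\<dots> \<le> (\<Sum>i. inner_content (U i))" using U(1) by (rule inner_UN_le)
  also have "\<dots> \<le> (\<Sum>n. outer_content (A n) + e * (1/2) ^ Suc n)"
    by (intro suminf_le U(3)) auto
  also have "... = (\<Sum>n. outer_content (A n)) + (\<Sum>n. ennreal e * ennreal ((1/2) ^ Suc n))"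
    using \<open>0 < e\<close> by (subst suminf_add[symmetric])
                     (auto simp del: ennreal_suminf_cmult simp add: ennreal_mult[symmetric])
  also have "\<dots> = (\<Sum>n. outer_content (A n)) + e"
    unfolding ennreal_suminf_cmult
    by (subst suminf_ennreal_eq[OF zero_le_power power_half_series]) auto
  finally show "outer_content (\<Union>i. A i) \<le> (\<Sum>n. outer_content (A n)) + e" .
qed

lemma outer_measure_space_outer: "outer_measure_space UNIV outer_content"
  unfolding outer_measure_space_def positive_def increasing_def countably_subadditive_def
  using outer_open[of "{}"] outer_mono outer_UN_le by (simp add: inner_empty)

lemma outer_Un_le: "outer_content (A \<union> B) \<le> outer_content A + outer_content B"
proof -
  have "subadditive (Pow UNIV) outer_content"
    using outer_measure_space_outer
    by (intro ring_of_sets.countably_subadditive_subadditive[OF ring_of_sets_Pow])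
       (auto simp: outer_measure_space_def)
  then show ?thesis by (simp add: subadditive_def)
       (metis (no_types) Diff_disjoint Un_Diff_cancel add_left_mono Diff_subset outer_mono order_trans)
qed

text \<open>This is the nontrivial half of Caratheodory's condition for \<open>U\<close>. Inside an
  open \<open>O'\<close>, a compact \<open>K \<subseteq> O' \<inter> U\<close> and a compact
  \<open>L \<subseteq> O' - K\<close> are disjoint, so their contents add up to at most that of
  \<open>O'\<close>. Suprema over \<open>L\<close> and then \<open>K\<close>, followed by the
  infimum over \<open>O' \<supseteq> A\<close>, give the claim.\<close>

lemma outer_split_open:
  assumes U: "open U" shows "outer_content (A \<inter> U) + outer_content (A - U) \<le> outer_content A"
proof -
  have main: "inner_content (O' \<inter> U) + outer_content (O' - U) \<le> inner_content O'" if O: "open O'" for O'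
  proof -
    have "l K + inner_content (O' - K) \<le> inner_content O'" if K: "compact K" "K \<subseteq> O' \<inter> U" for K
    proof -
      have "l K + inner_content (O' - K) = (SUP L\<in>{L. compact L \<and> L \<subseteq> O' - K}. l K + l L)"
        unfolding inner_content_def by (subst ennreal_SUP_add_right) auto
      also have "\<dots> \<le> inner_content O'"
      proof (rule SUP_least)
        fix L assume "L \<in> {L. compact L \<and> L \<subseteq> O' - K}"
        then have "l K + l L \<le> l (K \<union> L)" "l (K \<union> L) \<le> inner_content O'"
          using K by (auto intro!: l_add l_le_inner)
        then show "l K + l L \<le> inner_content O'" by (rule order_trans)
      qed
      finally show ?thesis .
    qed
    moreover have "outer_content (O' - U) \<le> inner_content (O' - K)" if K: "compact K" "K \<subseteq> O' \<inter> U" for K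
      using K O by (intro outer_le_inner open_Diff compact_imp_closed) auto
    ultimately have *: "l K + outer_content (O' - U) \<le> inner_content O'" if K: "compact K" "K \<subseteq> O' \<inter> U" for K
      using K by (meson add_left_mono order_trans)
    have "inner_content (O' \<inter> U) + outer_content (O' - U) = (SUP K\<in>{K. compact K \<and> K \<subseteq> O' \<inter> U}. l K + outer_content (O' - U))"
      unfolding inner_content_def by (subst ennreal_SUP_add_left) auto
    also have "\<dots> \<le> inner_content O'" using * by (intro SUP_least) auto
    finally show ?thesis .
  qed
  show ?thesis
    unfolding outer_content_def[of A]
  proof (rule INF_greatest)
    fix O' assume "O' \<in> {U. open U \<and> A \<subseteq> U}"
    then have O: "open O'" "A \<subseteq> O'" by auto
    have "outer_content (A \<inter> U) + outer_content (A - U) \<le> inner_content (O' \<inter> U) + outer_content (O' - U)"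
      using O U by (intro add_mono outer_le_inner outer_mono) auto
    also have "\<dots> \<le> inner_content O'" by (rule main[OF O(1)])
    finally show "outer_content (A \<inter> U) + outer_content (A - U) \<le> inner_content O'" .
  qed
qed

section \<open>The Borel measure induced by a content\<close>

definition radon :: "'a measure" where
  "radon = measure_of UNIV (sets borel) outer_content"

lemma sets_radon: "sets radon = sets borel"
  unfolding radon_def by (metis sets.sets_measure_of_eq space_borel)

lemma emeasure_radon:
  assumes "A \<in> sets borel" shows "emeasure radon A = outer_content A"
proof -
  have oms: "outer_measure_space (Pow UNIV) outer_content" using outer_measure_space_outer by simp
  \<comment> \<open>Caratheodory's lemma gives a measure on \<open>?L\<close>. This sigma-algebra
    contains the open sets by \<open>outer_split_open\<close>, hence all Borel sets.\<close>
  let ?L = "lambda_system UNIV (Pow UNIV) outer_content"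
  have ms: "measure_space UNIV ?L outer_content"
    by (rule sigma_algebra.caratheodory_lemma[OF sigma_algebra_Pow oms])
  then interpret L: sigma_algebra UNIV ?L by (simp add: measure_space_def)
  have "U \<in> ?L" if "open U" for U
  proof -
    have "outer_content (A \<inter> U) + outer_content (A - U) = outer_content A" for A
      using outer_split_open[OF that, of A] outer_Un_le[of "A \<inter> U" "A - U"] by (simp add: Int_Diff_Un antisym)
    then show ?thesis unfolding algebra.lambda_system_eq[OF algebra_Pow] by simp
  qed
  then have "sets borel \<subseteq> ?L"
    unfolding sets_borel by (intro L.sigma_sets_subset) auto
  then have "measure_space UNIV (sets borel) outer_content"
    by (intro measure_down[OF ms]) (metis sets.sigma_algebra_axioms space_borel)
  then show ?thesis
    using assms by (simp add: radon_def emeasure_measure_of_sigma measure_space_def)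
qed

text \<open>Transfers invariance from the content to the measure; \<open>h\<close> is the inverse of
  the homeomorphism \<open>f\<close>. It is applied to right translations.\<close>

lemma outer_image:
  assumes f: "\<And>K. compact K \<Longrightarrow> compact (f ` K) \<and> l (f ` K) = l K" "\<And>K. compact K \<Longrightarrow> compact (h ` K)"
    and op: "\<And>U. open U \<Longrightarrow> open (f ` U)" "\<And>U. open U \<Longrightarrow> open (h ` U)"
    and inv: "\<And>x. f (h x) = x" "\<And>x. h (f x) = x"
  shows "outer_content (f ` A) = outer_content A"
proof -
  have hf: "h ` f ` S = S" "f ` h ` S = S" for S using inv by (auto simp: image_image)
  have 1: "inner_content (f ` U) = inner_content U" for U
    unfolding inner_content_def
  proof (rule SUP_eq)
    fix K assume "K \<in> {K. compact K \<and> K \<subseteq> f ` U}"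
    then have K: "compact (h ` K)" "h ` K \<subseteq> U" "l (h ` K) = l K"
      using f hf image_mono[of K "f ` U" h] by (auto) metis+
    then show "\<exists>K'\<in>{K. compact K \<and> K \<subseteq> U}. l K \<le> l K'" by (intro bexI[of _ "h ` K"]) auto
  next
    fix K assume "K \<in> {K. compact K \<and> K \<subseteq> U}"
    then show "\<exists>K'\<in>{K. compact K \<and> K \<subseteq> f ` U}. l K \<le> l K'" using f by (intro bexI[of _ "f ` K"]) auto
  qed
  show ?thesis
    unfolding outer_content_def
  proof (rule INF_eq)
    fix U assume "U \<in> {U. open U \<and> A \<subseteq> U}"
    then show "\<exists>U'\<in>{U. open U \<and> f ` A \<subseteq> U}. inner_content U' \<le> inner_content U"
      using op 1 by (intro bexI[of _ "f ` U"]) auto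
  next
    fix U assume "U \<in> {U. open U \<and> f ` A \<subseteq> U}"
    then have "open (h ` U)" "A \<subseteq> h ` U" "inner_content (h ` U) = inner_content U"
      using op 1[of "h ` U"] hf image_mono[of "f ` A" U h] by auto
    then show "\<exists>U'\<in>{U. open U \<and> A \<subseteq> U}. inner_content U' \<le> inner_content U"
      by (intro bexI[of _ "h ` U"]) auto
  qed
qed

end

section \<open>Existence of a right Haar measure\<close>

text \<open>Two infima are approximated at independent indices \<open>i\<close> and
  \<open>j\<close>. For coset counts the two indices are subgroups, which are then replaced by their
  intersection.\<close>

lemma le_INF_add_INF_ennreal:
  fixes f g :: "_ \<Rightarrow> ennreal"
  assumes "\<And>i j. i \<in> I \<Longrightarrow> j \<in> I \<Longrightarrow> a \<le> f i + g j"
  shows "a \<le> (INF i\<in>I. f i) + (INF i\<in>I. g i)"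
proof (rule ennreal_le_epsilon)
  fix e :: real assume fin: "(INF i\<in>I. f i) + (INF i\<in>I. g i) < top" and e: "0 < e"
  have lt: "x < x + ennreal (e/2)" if "x < top" for x
    using that e by (auto simp: less_top)
  have "(INF i\<in>I. f i) < top" "(INF i\<in>I. g i) < top" using fin by (simp_all only: ennreal_add_less_top)
  then obtain i j where ij: "i \<in> I" "f i < (INF i\<in>I. f i) + ennreal (e/2)"
      "j \<in> I" "g j < (INF i\<in>I. g i) + ennreal (e/2)"
    using lt[THEN INF_less_iff[THEN iffD1]] by blast
  have "a \<le> f i + g j" using assms ij by auto
  also have "\<dots> \<le> ((INF i\<in>I. f i) + ennreal (e/2)) + ((INF i\<in>I. g i) + ennreal (e/2))"
    using ij by (intro add_mono less_imp_le)
  also have "\<dots> = (INF i\<in>I. f i) + (INF i\<in>I. g i) + (ennreal (e/2) + ennreal (e/2))"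
    by (simp add: ac_simps)
  also have "ennreal (e/2) + ennreal (e/2) = ennreal e" using e by (simp flip: ennreal_plus)
  finally show "a \<le> (INF i\<in>I. f i) + (INF i\<in>I. g i) + ennreal e" .
qed

section \<open>Counting cosets\<close>

lemma card_rcos_image_add_right: "card (rcos W ` (\<lambda>x. x + g) ` S) = card (rcos W ` S)"
proof -
  have "rcos W ` (\<lambda>x. x + g) ` S = (\<lambda>c. (\<lambda>x. x + g) ` c) ` rcos W ` S"
    by (simp add: image_image image_add_right_rcos)
  moreover have "inj (\<lambda>x::'a. x + g)" by (simp add: inj_def)
  ultimately show ?thesis by (metis card_image inj_image_eq_iff injI inj_on_subset subset_UNIV)
qed

text \<open>Multiplicativity of the index. Right translation carries \<open>W\<close> to each of its
  cosets, so all split into equally many cosets of \<open>W'\<close>, and distinct cosets of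
  \<open>W\<close> share none.\<close>

lemma card_rcos_refine:
  assumes W: "open_subgroup W" "open_subgroup W'" "W' \<subseteq> W" and fin: "finite (rcos W ` S)"
    and fin': "finite (rcos W' ` W)"
  shows "finite (rcos W' ` \<Union>(rcos W ` S))"
    "card (rcos W' ` \<Union>(rcos W ` S)) = card (rcos W ` S) * card (rcos W' ` W)"
proof -
  have c: "card (rcos W' ` c) = card (rcos W' ` W)" if "c \<in> rcos W ` S" for c
    using that card_rcos_image_add_right[of W' _ W] by (auto simp: rcos_def[of W])
  have f: "finite (rcos W' ` c)" if "c \<in> rcos W ` S" for c
  proof -
    \<comment> \<open>Since \<open>card\<close> is 0 on infinite sets, positive cardinality passes
      finiteness from \<open>W\<close> to its coset \<open>c\<close>.\<close>
    have "card (rcos W' ` W) > 0" using fin' W by (auto simp: card_gt_0_iff open_subgroup_def)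
    then show ?thesis using c[OF that] by (metis card_gt_0_iff)
  qed
  have eq: "rcos W' ` \<Union>(rcos W ` S) = (\<Union>c\<in>rcos W ` S. rcos W' ` c)" by blast
  show "finite (rcos W' ` \<Union>(rcos W ` S))" unfolding eq using f fin by blast
  have disj: "rcos W' ` c \<inter> rcos W' ` d = {}" if cd: "c \<in> rcos W ` S" "d \<in> rcos W ` S" "c \<noteq> d" for c d
  proof (rule ccontr)
    assume "rcos W' ` c \<inter> rcos W' ` d \<noteq> {}"
    then obtain x y where xy: "x \<in> c" "y \<in> d" "rcos W' x = rcos W' y" by auto
    then have "x - y \<in> W" using W rcos_eq_iff by blast
    moreover obtain a b where "c = rcos W a" "d = rcos W b" using cd by auto
    ultimately show False
      using xy cd(3) W(1) by (metis mem_rcos_iff rcos_eq_iff)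
  qed
  have "card (\<Union>c\<in>rcos W ` S. rcos W' ` c) = (\<Sum>c\<in>rcos W ` S. card (rcos W' ` c))"
    using f disj fin by (intro card_UN_disjoint) auto
  then show "card (rcos W' ` \<Union>(rcos W ` S)) = card (rcos W ` S) * card (rcos W' ` W)"
    unfolding eq using c by simp
qed

lemma Union_rcos_subgroup:
  assumes "open_subgroup W" "open_subgroup V" "W \<subseteq> V"
  shows "\<Union>(rcos W ` V) = V"
proof
  show "V \<subseteq> \<Union>(rcos W ` V)" using self_mem_rcos[OF assms(1)] by auto
  show "\<Union>(rcos W ` V) \<subseteq> V" using assms by (auto simp: rcos_def open_subgroup_def)
qed

lemma borel_image_add_right:
  "A \<in> sets borel \<Longrightarrow> (\<lambda>x::'a::topological_group_add. x + g) ` A \<in> sets borel"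
  unfolding image_add_right_eq_vimage
  by (rule measurable_sets_borel[OF borel_measurable_continuous_onI[OF continuous_on_add_right]])

lemma borel_image_add_left:
  "A \<in> sets borel \<Longrightarrow> (\<lambda>x::'a::topological_group_add. g + x) ` A \<in> sets borel"
  unfolding image_add_left_eq_vimage
  by (rule measurable_sets_borel[OF borel_measurable_continuous_onI[OF continuous_on_add_left]])

context td_group
begin

definition subs :: "'g set set" where
  "subs = {W. open_subgroup W \<and> W \<subseteq> V}"

text \<open>If \<open>V\<close> has mass 1, a coset of \<open>W\<close> has mass 1 divided by the
  index of \<open>W\<close> in \<open>V\<close>. The ratio is thus the mass of the union of the
  cosets that meet \<open>S\<close>, an upper estimate for \<open>S\<close>.\<close>

definition ratio :: "'g set \<Rightarrow> 'g set \<Rightarrow> real" where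
  "ratio W S = real (card (rcos W ` S)) / real (card (rcos W ` V))"

text \<open>The ratios decrease as \<open>W\<close> shrinks, so the infimum is their limit along the directed set of
  open subgroups of \<open>V\<close>.\<close>

definition haar_content :: "'g set \<Rightarrow> ennreal" where
  "haar_content S = (INF W\<in>subs. ennreal (ratio W S))"

lemma V_in_subs: "V \<in> subs"
  using V by (simp add: subs_def)

lemma subs_Int: "W \<in> subs \<Longrightarrow> W' \<in> subs \<Longrightarrow> W \<inter> W' \<in> subs"
  by (auto simp: subs_def open_subgroup_Int)

lemma subs_open_subgroup: "W \<in> subs \<Longrightarrow> open_subgroup W"
  by (simp add: subs_def)

lemma subs_compact: "W \<in> subs \<Longrightarrow> compact W"
  using closed_open_subgroup compact_V unfolding subs_def
  by (metis (lifting) compact_Int_closed inf.absorb_iff2 mem_Collect_eq)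

lemma subs_finite: "W \<in> subs \<Longrightarrow> compact K \<Longrightarrow> finite (rcos W ` K)"
  by (simp add: compact_imp_finite_rcos subs_def)

lemma card_rcos_V_pos: "W \<in> subs \<Longrightarrow> card (rcos W ` V) > 0"
  using V by (auto simp: card_gt_0_iff subs_finite compact_V open_subgroup_def)

lemma ratio_nonneg: "ratio W S \<ge> 0"
  by (simp add: ratio_def)

lemma card_rcos_V:
  assumes "W \<in> subs" "W' \<in> subs" "W' \<subseteq> W"
  shows "card (rcos W' ` V) = card (rcos W ` V) * card (rcos W' ` W)"
  using card_rcos_refine(2)[of W W' V] Union_rcos_subgroup[of W V] assms V
  by (simp add: subs_open_subgroup subs_finite compact_V subs_compact) (simp add: subs_def)

text \<open>Passing from \<open>W\<close> to \<open>W'\<close> multiplies the denominator by exactly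
  the index of \<open>W'\<close> in \<open>W\<close>, and the numerator by at most that
  index.\<close>

lemma ratio_refine:
  assumes W: "W \<in> subs" "W' \<in> subs" "W' \<subseteq> W" and K: "compact K"
  shows "ratio W' K \<le> ratio W K"
proof -
  have "K \<subseteq> \<Union>(rcos W ` K)" using self_mem_rcos subs_open_subgroup[OF W(1)] by auto
  then have "card (rcos W' ` K) \<le> card (rcos W' ` \<Union>(rcos W ` K))"
    using card_rcos_refine(1)[of W W' K] W K
    by (intro card_mono image_mono) (auto simp: subs_open_subgroup subs_finite subs_compact)
  also have "\<dots> = card (rcos W ` K) * card (rcos W' ` W)"
    using W K by (intro card_rcos_refine(2)) (auto simp: subs_open_subgroup subs_finite subs_compact)
  finally have "real (card (rcos W' ` K)) \<le> real (card (rcos W ` K)) * real (card (rcos W' ` W))"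
    by (metis of_nat_le_iff of_nat_mult)
  moreover have "card (rcos W' ` W) > 0"
    using card_rcos_V[OF W] card_rcos_V_pos[OF W(2)] by (metis mult_0_right neq0_conv)
  moreover have "card (rcos W ` V) > 0" by (rule card_rcos_V_pos[OF W(1)])
  ultimately show ?thesis
    unfolding ratio_def card_rcos_V[OF W] by (simp add: field_simps)
qed

lemma ratio_mono:
  assumes "W \<in> subs" "compact L" "K \<subseteq> L" shows "ratio W K \<le> ratio W L"
  unfolding ratio_def using assms by (intro divide_right_mono) (auto intro!: card_mono subs_finite)

lemma haar_content_le: "W \<in> subs \<Longrightarrow> haar_content K \<le> ennreal (ratio W K)"
  unfolding haar_content_def by (rule INF_lower)

sublocale haar: compact_content haar_content
proof
  show "haar_content {} = 0"
    using haar_content_le[OF V_in_subs, of "{}"] by (simp add: ratio_def)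
next
  fix K L :: "'g set" assume KL: "compact K" "compact L"
  show "haar_content K \<le> haar_content L" if "K \<subseteq> L"
    unfolding haar_content_def using KL that
    by (intro INF_mono) (auto intro!: ennreal_leI ratio_mono)
  show "haar_content (K \<union> L) \<le> haar_content K + haar_content L"
    unfolding haar_content_def[of K] haar_content_def[of L]
  proof (rule le_INF_add_INF_ennreal)
    fix W1 W2 assume W: "W1 \<in> subs" "W2 \<in> subs"
    let ?W = "W1 \<inter> W2"
    have "haar_content (K \<union> L) \<le> ennreal (ratio ?W (K \<union> L))" using W by (intro haar_content_le subs_Int)
    also have "ratio ?W (K \<union> L) \<le> ratio ?W K + ratio ?W L"
      unfolding ratio_def image_Un add_divide_distrib[symmetric]
      by (intro divide_right_mono) (auto simp flip: of_nat_add intro: card_Un_le)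
    also have "\<dots> \<le> ratio W1 K + ratio W2 L"
      using W KL by (intro add_mono ratio_refine subs_Int) auto
    finally show "haar_content (K \<union> L) \<le> ennreal (ratio W1 K) + ennreal (ratio W2 L)"
      by (simp add: ennreal_leI ratio_nonneg flip: ennreal_plus)
  qed
  show "haar_content K + haar_content L \<le> haar_content (K \<union> L)" if disj: "K \<inter> L = {}"
  proof -
    \<comment> \<open>For additivity, \<open>W0\<close> is chosen so that its cosets through
      \<open>K\<close> avoid \<open>L\<close>. Below \<open>W0\<close> no coset meets both sets, so
      the counts add exactly.\<close>
    have "open (- L)" "K \<subseteq> - L" using KL disj by (auto simp: compact_imp_closed open_Compl)
    then obtain W0 where W0: "open_subgroup W0" "W0 \<subseteq> V" "\<And>x. x \<in> K \<Longrightarrow> rcos W0 x \<subseteq> - L"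
      using lebesgue_subgroup[OF KL(1), of "{- L}"] by auto
    then have W0s: "W0 \<in> subs" by (simp add: subs_def)
    show ?thesis
      unfolding haar_content_def[of "K \<union> L"]
    proof (rule INF_greatest)
      fix W assume W: "W \<in> subs"
      let ?W = "W \<inter> W0"
      have Ws: "?W \<in> subs" using W W0s by (rule subs_Int)
      have "rcos ?W ` K \<inter> rcos ?W ` L = {}"
      proof (rule ccontr)
        assume "rcos ?W ` K \<inter> rcos ?W ` L \<noteq> {}"
        then obtain x y where xy: "x \<in> K" "y \<in> L" "rcos ?W x = rcos ?W y" by auto
        then have "y \<in> rcos ?W x" using self_mem_rcos[OF subs_open_subgroup[OF Ws]] by auto
        then have "y \<in> rcos W0 x" using rcos_mono[of ?W W0 x] by auto
        then show False using W0(3)[OF xy(1)] xy(2) by auto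
      qed
      then have "card (rcos ?W ` (K \<union> L)) = card (rcos ?W ` K) + card (rcos ?W ` L)"
        using Ws KL unfolding image_Un by (intro card_Un_disjoint subs_finite)
      then have eq: "ratio ?W (K \<union> L) = ratio ?W K + ratio ?W L"
        by (simp add: ratio_def add_divide_distrib)
      have "haar_content K + haar_content L \<le> ennreal (ratio ?W K) + ennreal (ratio ?W L)"
        using Ws by (intro add_mono haar_content_le)
      also have "\<dots> = ennreal (ratio ?W (K \<union> L))"
        unfolding eq by (simp add: ratio_nonneg)
      also have "\<dots> \<le> ennreal (ratio W (K \<union> L))"
        using W Ws KL by (intro ennreal_leI ratio_refine) auto
      finally show "haar_content K + haar_content L \<le> ennreal (ratio W (K \<union> L))" .
    qed
  qed
qed

lemma haar_content_add_right: "haar_content ((\<lambda>x. x + g) ` S) = haar_content S"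
  by (simp add: haar_content_def ratio_def card_rcos_image_add_right)

text \<open>A coset of \<open>W\<close> splits into as many cosets of \<open>W \<inter> W'\<close>
  as \<open>W\<close> does, so its ratio is exactly the reciprocal of the index of \<open>W\<close>
  in \<open>V\<close>. This bounds the ratio at every \<open>W'\<close> from below.\<close>

lemma haar_content_rcos_pos:
  assumes W: "W \<in> subs" shows "haar_content (rcos W x) > 0"
proof -
  have "ennreal (1 / card (rcos W ` V)) \<le> haar_content (rcos W x)"
    unfolding haar_content_def
  proof (rule INF_greatest)
    fix W' assume W': "W' \<in> subs"
    let ?W = "W \<inter> W'"
    have Ws: "?W \<in> subs" using W W' by (rule subs_Int)
    have "card (rcos ?W ` rcos W x) = card (rcos ?W ` W)"
      unfolding rcos_def[of W] by (rule card_rcos_image_add_right)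
    moreover have "card (rcos ?W ` V) = card (rcos W ` V) * card (rcos ?W ` W)"
      using card_rcos_V[OF W Ws] by simp
    moreover have "card (rcos ?W ` V) > 0" using Ws by (rule card_rcos_V_pos)
    ultimately have "ratio ?W (rcos W x) = 1 / card (rcos W ` V)"
      by (simp add: ratio_def)
    moreover have "ratio ?W (rcos W x) \<le> ratio W' (rcos W x)"
      using W' Ws W by (intro ratio_refine compact_rcos subs_compact) auto
    ultimately show "ennreal (1 / card (rcos W ` V)) \<le> ennreal (ratio W' (rcos W x))"
      by (simp add: ennreal_leI)
  qed
  moreover have "ennreal (1 / card (rcos W ` V)) > 0"
    using card_rcos_V_pos[OF W] by simp
  ultimately show ?thesis by (rule less_le_trans[rotated])
qed

text \<open>Saturating \<open>K\<close> by a small \<open>W\<close> gives a finite union of compact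
  open cosets between \<open>K\<close> and \<open>U\<close>; the measure of such a union is found by
  counting.\<close>

lemma compact_subset_compact_open:
  assumes K: "compact K" "open U" "K \<subseteq> U"
  obtains W where "W \<in> subs" "\<Union>(rcos W ` K) \<subseteq> U" "K \<subseteq> \<Union>(rcos W ` K)"
    "compact (\<Union>(rcos W ` K))" "open (\<Union>(rcos W ` K))"
proof -
  obtain W where W: "open_subgroup W" "W \<subseteq> V" "\<And>x. x \<in> K \<Longrightarrow> rcos W x \<subseteq> U"
    using lebesgue_subgroup[OF K(1), of "{U}"] K by auto
  then have Ws: "W \<in> subs" by (simp add: subs_def)
  show thesis
  proof (rule that[OF Ws])
    show "\<Union>(rcos W ` K) \<subseteq> U" using W(3) by auto
    show "K \<subseteq> \<Union>(rcos W ` K)" using self_mem_rcos[OF W(1)] by auto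
    show "compact (\<Union>(rcos W ` K))"
      using Ws K by (intro compact_Union) (auto intro: subs_finite compact_rcos subs_compact)
    show "open (\<Union>(rcos W ` K))" using W(1) by (auto intro!: open_rcos simp: open_subgroup_def)
  qed
qed

section \<open>Verification of the Haar measure axioms\<close>

theorem right_haar_radon: "right_haar haar.radon"
  unfolding right_haar_def
proof (intro conjI ballI allI impI)
  show "sets haar.radon = sets borel" by (rule haar.sets_radon)
  show "emeasure haar.radon ((\<lambda>x. x + g) ` A) = emeasure haar.radon A" if "A \<in> sets borel" for A g
  proof -
    have "(\<lambda>x. x + g) ` A \<in> sets borel" using that by (rule borel_image_add_right)
    moreover have "haar.outer_content ((\<lambda>x. x + g) ` A) = haar.outer_content A"
      by (rule haar.outer_image[where h = "\<lambda>x. x + - g"])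
         (auto simp: haar_content_add_right add.assoc simp del: add_uminus_conv_diff
           intro!: open_image_add_right compact_continuous_image continuous_on_add_right)
    ultimately show ?thesis using that by (simp add: haar.emeasure_radon)
  qed
  show "emeasure haar.radon K < \<infinity>" if K: "compact K" for K
  proof -
    obtain W where W: "K \<subseteq> \<Union>(rcos W ` K)" "compact (\<Union>(rcos W ` K))" "open (\<Union>(rcos W ` K))"
      by (rule compact_subset_compact_open[OF K open_UNIV subset_UNIV])
    have "haar.outer_content K \<le> haar.inner_content (\<Union>(rcos W ` K))"
      using W by (intro haar.outer_le_inner)
    also have "\<dots> \<le> haar_content (\<Union>(rcos W ` K))"
      unfolding haar.inner_content_def using W by (intro SUP_least haar.l_mono) auto
    also have "\<dots> \<le> ennreal (ratio V (\<Union>(rcos W ` K)))" by (rule haar_content_le[OF V_in_subs])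
    also have "\<dots> < \<infinity>" by simp
    finally show ?thesis using K by (simp add: haar.emeasure_radon borel_compact)
  qed
  show "emeasure haar.radon U > 0" if U: "open U \<and> U \<noteq> {}" for U
  proof -
    obtain x where x: "x \<in> U" using U by auto
    then obtain W where W: "W \<in> subs" "\<Union>(rcos W ` {x}) \<subseteq> U"
      using U compact_subset_compact_open[of "{x}" U] by auto
    then have "haar_content (rcos W x) \<le> haar.inner_content U"
      by (intro haar.l_le_inner compact_rcos subs_compact) auto
    then show ?thesis
      using haar_content_rcos_pos[OF W(1), of x] U
      by (simp add: haar.emeasure_radon haar.outer_open less_le_trans)
  qed
  show "emeasure haar.radon A = (INF U\<in>{U. open U \<and> A \<subseteq> U}. emeasure haar.radon U)" if "A \<in> sets borel" for A
    unfolding haar.emeasure_radon[OF that] haar.outer_content_def[of A]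
    by (rule INF_cong) (simp_all add: haar.emeasure_radon haar.outer_open)
  show "emeasure haar.radon U = (SUP K\<in>{K. compact K \<and> K \<subseteq> U}. emeasure haar.radon K)" if U: "open U" for U
  proof (rule antisym)
    have "haar_content K \<le> haar.outer_content K" if "compact K" for K
      unfolding haar.outer_content_def using that by (intro INF_greatest haar.l_le_inner) auto
    then show "emeasure haar.radon U \<le> (SUP K\<in>{K. compact K \<and> K \<subseteq> U}. emeasure haar.radon K)"
      using U by (auto simp: haar.emeasure_radon haar.outer_open haar.inner_content_def borel_compact intro!: SUP_mono)
    show "(SUP K\<in>{K. compact K \<and> K \<subseteq> U}. emeasure haar.radon K) \<le> emeasure haar.radon U"
      using U by (intro SUP_least emeasure_mono) (auto simp: haar.sets_radon)
  qed
qed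

end

section \<open>The modular function\<close>

lemma image_add_left_cancel [simp]:
  "(\<lambda>x. - g + x) ` (\<lambda>x. g + x) ` A = (A :: 'a::group_add set)"
  "(\<lambda>x. g + x) ` (\<lambda>x. - g + x) ` A = A"
  by (simp_all add: image_image flip: add.assoc)

text \<open>\<open>M\<close> is an arbitrary right Haar measure, since the modular function refers
  to an unspecified choice of one.\<close>

locale haar_measure = td_group V for V :: "'g::{topological_group_add, t2_space} set" +
  fixes M :: "'g measure"
  assumes M: "right_haar M"
begin

lemma sets_M [simp]: "sets M = sets borel"
  by (rule M[unfolded right_haar_def, THEN conjunct1])

lemma M_add_right: "A \<in> sets borel \<Longrightarrow> emeasure M ((\<lambda>x. x + g) ` A) = emeasure M A"
  using M[unfolded right_haar_def, THEN conjunct2, THEN conjunct1] by blast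

lemma M_compact: "compact K \<Longrightarrow> emeasure M K < \<infinity>"
  using M[unfolded right_haar_def, THEN conjunct2, THEN conjunct2, THEN conjunct1] by blast

lemma M_open: "open U \<Longrightarrow> U \<noteq> {} \<Longrightarrow> emeasure M U > 0"
  using M[unfolded right_haar_def, THEN conjunct2, THEN conjunct2, THEN conjunct2, THEN conjunct1] by blast

lemma M_outer: "A \<in> sets borel \<Longrightarrow> emeasure M A = (INF U\<in>{U. open U \<and> A \<subseteq> U}. emeasure M U)"
  using M[unfolded right_haar_def, THEN conjunct2, THEN conjunct2, THEN conjunct2, THEN conjunct2, THEN conjunct1] by blast

lemma M_inner: "open U \<Longrightarrow> emeasure M U = (SUP K\<in>{K. compact K \<and> K \<subseteq> U}. emeasure M K)"
  using M[unfolded right_haar_def, THEN conjunct2, THEN conjunct2, THEN conjunct2, THEN conjunct2, THEN conjunct2] by blast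

lemma M_mono: "A \<subseteq> B \<Longrightarrow> B \<in> sets borel \<Longrightarrow> emeasure M A \<le> emeasure M B"
  by (rule emeasure_mono) simp_all

text \<open>Left translation by \<open>g\<close> turns cosets of \<open>W\<close> into right
  translates of \<open>g + W\<close>, which all have the same mass. The case \<open>g = 0\<close> is
  the untranslated formula.\<close>

lemma emeasure_Union_rcos:
  assumes W: "W \<in> subs" and fin: "finite (rcos W ` S)"
  shows "emeasure M ((\<lambda>x. g + x) ` \<Union>(rcos W ` S)) =
    of_nat (card (rcos W ` S)) * emeasure M ((\<lambda>x. g + x) ` W)"
proof -
  let ?t = "\<lambda>A. (\<lambda>x. g + x) ` A"
  have oW: "open W" using W by (simp add: subs_def open_subgroup_def)
  have one: "emeasure M (?t c) = emeasure M (?t W)" if c: "c \<in> rcos W ` S" for c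
  proof -
    obtain x where "c = rcos W x" using c by auto
    then have "?t c = (\<lambda>y. y + x) ` ?t W" by (simp add: rcos_def image_image add.assoc)
    then show ?thesis using M_add_right open_image_add_left[OF oW] by simp
  qed
  have "disjoint_family_on ?t (rcos W ` S)"
    unfolding disjoint_family_on_def
  proof (intro ballI impI)
    fix c d assume cd: "c \<in> rcos W ` S" "d \<in> rcos W ` S" "c \<noteq> d"
    have "c = rcos W z" "d = rcos W z" if "z \<in> c \<inter> d" for z
      using that cd(1,2) rcos_eqI[OF subs_open_subgroup[OF W]] by blast+
    then have "c \<inter> d = {}" using cd(3) by blast
    then show "?t c \<inter> ?t d = {}" by auto
  qed
  then have "emeasure M (\<Union>c\<in>rcos W ` S. ?t c) = (\<Sum>c\<in>rcos W ` S. emeasure M (?t c))"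
    using fin oW by (intro sum_emeasure[symmetric]) (auto intro!: borel_open open_image_add_left open_rcos)
  also have "\<dots> = of_nat (card (rcos W ` S)) * emeasure M (?t W)"
    using one by simp
  finally show ?thesis by (simp add: image_UN)
qed

lemma emeasure_V:
  assumes W: "W \<in> subs"
  shows "emeasure M ((\<lambda>x. g + x) ` V) = of_nat (card (rcos W ` V)) * emeasure M ((\<lambda>x. g + x) ` W)"
proof -
  have "\<Union>(rcos W ` V) = V" using W V by (intro Union_rcos_subgroup) (auto simp: subs_def)
  then show ?thesis using emeasure_Union_rcos[OF W subs_finite[OF W compact_V], of g] by simp
qed

text \<open>The masses of \<open>g + V\<close> and \<open>V\<close> are the same multiple of those
  of \<open>g + W\<close> and \<open>W\<close>, namely by the index of \<open>W\<close> in
  \<open>V\<close>. Hence the scaling factor read off from \<open>V\<close> is right for every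
  \<open>W\<close>.\<close>

lemma ex_modular_subs:
  obtains r where "r > 0" "\<And>W. W \<in> subs \<Longrightarrow> emeasure M ((\<lambda>x. g + x) ` W) = ennreal r * emeasure M W"
proof -
  let ?t = "\<lambda>A. (\<lambda>x. g + x) ` A"
  define b where "b A = enn2real (emeasure M A)" for A
  have b: "emeasure M W = ennreal (b W)" "emeasure M (?t W) = ennreal (b (?t W))" "b W > 0" "b (?t W) > 0"
    if W: "W \<in> subs" for W
  proof -
    have "compact (?t W)" "open W" "W \<noteq> {}" "compact W" "open (?t W)"
      using W subs_compact[OF W]
      by (auto simp: subs_def open_subgroup_def intro!: open_image_add_left compact_continuous_image continuous_on_add_left)
    then have "0 < emeasure M W" "emeasure M W < \<infinity>" "0 < emeasure M (?t W)" "emeasure M (?t W) < \<infinity>"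
      by (auto intro!: M_open M_compact simp del: infinity_ennreal_def)
    then show "emeasure M W = ennreal (b W)" "emeasure M (?t W) = ennreal (b (?t W))" "b W > 0" "b (?t W) > 0"
      unfolding b_def by (auto simp: enn2real_positive_iff less_top)
  qed
  show thesis
  proof
    show "b (?t V) / b V > 0" using b[OF V_in_subs] by simp
    fix W assume W: "W \<in> subs"
    let ?n = "real (card (rcos W ` V))"
    have n: "?n > 0" using card_rcos_V_pos[OF W] by simp
    have "ennreal (b (?t V)) = ennreal (?n * b (?t W))"
      using emeasure_V[OF W, of g] b[OF V_in_subs] b[OF W] by (simp add: ennreal_mult ennreal_of_nat_eq_real_of_nat)
    then have 1: "b (?t V) = ?n * b (?t W)" using b[OF V_in_subs] b[OF W] n by simp
    have "ennreal (b V) = ennreal (?n * b W)"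
      using emeasure_V[OF W, of 0] b[OF V_in_subs] b[OF W] by (simp add: ennreal_mult ennreal_of_nat_eq_real_of_nat)
    then have 2: "b V = ?n * b W" using b[OF V_in_subs] b[OF W] n by simp
    have "b (?t W) = b (?t V) / b V * b W" unfolding 1 2 using n b[OF W] by simp
    then show "emeasure M (?t W) = ennreal (b (?t V) / b V) * emeasure M W"
      using b[OF V_in_subs] b[OF W] by (simp flip: ennreal_mult)
  qed
qed

text \<open>The factor extends from subgroups to finite unions of cosets by counting, to open sets
  by inner regularity, and to Borel sets by outer regularity.\<close>

lemma ex_modular:
  "\<exists>r>0. \<forall>A\<in>sets borel. emeasure M ((\<lambda>x. g + x) ` A) = ennreal r * emeasure M A"
proof -
  let ?t = "\<lambda>A. (\<lambda>x. g + x) ` A"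
  obtain r where r: "r > 0" "\<And>W. W \<in> subs \<Longrightarrow> emeasure M (?t W) = ennreal r * emeasure M W"
    using ex_modular_subs[of g] by blast
  have cosets: "emeasure M (?t (\<Union>(rcos W ` K))) = ennreal r * emeasure M (\<Union>(rcos W ` K))"
    if "W \<in> subs" "compact K" for W K
    using emeasure_Union_rcos[OF that(1) subs_finite[OF that], of g]
      emeasure_Union_rcos[OF that(1) subs_finite[OF that], of 0] r(2)[OF that(1)]
    by (simp add: ac_simps)
  have op: "emeasure M (?t U) = ennreal r * emeasure M U" if U: "open U" for U
  proof (rule antisym)
    have tU: "open (?t U)" using U by (rule open_image_add_left)
    show "emeasure M (?t U) \<le> ennreal r * emeasure M U"
      unfolding M_inner[OF tU]
    proof (rule SUP_least)
      fix K assume "K \<in> {K. compact K \<and> K \<subseteq> ?t U}"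
      then have K: "compact K" "K \<subseteq> ?t U" by auto
      let ?K = "(\<lambda>x. - g + x) ` K"
      have "compact ?K" using K by (intro compact_continuous_image continuous_on_add_left)
      moreover have "?K \<subseteq> U" using image_mono[OF K(2), of "\<lambda>x. - g + x"] by simp
      ultimately obtain W where W: "W \<in> subs" "\<Union>(rcos W ` ?K) \<subseteq> U" "?K \<subseteq> \<Union>(rcos W ` ?K)"
          "open (\<Union>(rcos W ` ?K))"
        using compact_subset_compact_open[of ?K U] U by metis
      have "K \<subseteq> ?t (\<Union>(rcos W ` ?K))"
        using image_mono[OF W(3), of "\<lambda>x. g + x"] unfolding image_add_left_cancel .
      then have "emeasure M K \<le> emeasure M (?t (\<Union>(rcos W ` ?K)))"
        using W(4) by (intro M_mono borel_open open_image_add_left)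
      also have "\<dots> = ennreal r * emeasure M (\<Union>(rcos W ` ?K))" by (rule cosets[OF W(1) \<open>compact ?K\<close>])
      also have "\<dots> \<le> ennreal r * emeasure M U" using W U by (intro mult_left_mono M_mono) auto
      finally show "emeasure M K \<le> ennreal r * emeasure M U" .
    qed
    show "ennreal r * emeasure M U \<le> emeasure M (?t U)"
      unfolding M_inner[OF U] SUP_mult_left_ennreal
    proof (rule SUP_least)
      fix K assume "K \<in> {K. compact K \<and> K \<subseteq> U}"
      then have K: "compact K" "K \<subseteq> U" by auto
      then obtain W where W: "W \<in> subs" "\<Union>(rcos W ` K) \<subseteq> U" "K \<subseteq> \<Union>(rcos W ` K)"
          "open (\<Union>(rcos W ` K))"
        using compact_subset_compact_open[of K U] U by metis
      have "ennreal r * emeasure M K \<le> ennreal r * emeasure M (\<Union>(rcos W ` K))"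
        using W by (intro mult_left_mono M_mono) auto
      also have "\<dots> = emeasure M (?t (\<Union>(rcos W ` K)))" using cosets[OF W(1) K(1)] by simp
      also have "\<dots> \<le> emeasure M (?t U)" using W(2) tU by (intro M_mono image_mono) auto
      finally show "ennreal r * emeasure M K \<le> emeasure M (?t U)" .
    qed
  qed
  have "emeasure M (?t A) = ennreal r * emeasure M A" if A: "A \<in> sets borel" for A
  proof (rule antisym)
    have tA: "?t A \<in> sets borel" using A by (rule borel_image_add_left)
    have inv: "ennreal (1 / r) * (ennreal r * x) = x" "ennreal r * (ennreal (1 / r) * x) = x" for x
      using r(1) by (simp_all flip: mult.assoc ennreal_mult)
    \<comment> \<open>Moving \<open>r\<close> to the other side leaves a lower bound for the infimum
      over open supersets of \<open>A\<close>, which can be checked on each of them.\<close>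
    have "ennreal (1 / r) * emeasure M (?t A) \<le> emeasure M A"
      unfolding M_outer[OF A]
    proof (rule INF_greatest)
      fix U assume "U \<in> {U. open U \<and> A \<subseteq> U}"
      then have U: "open U" "A \<subseteq> U" by auto
      have "ennreal (1 / r) * emeasure M (?t A) \<le> ennreal (1 / r) * emeasure M (?t U)"
        using U by (intro mult_left_mono M_mono image_mono borel_open open_image_add_left) auto
      also have "\<dots> = emeasure M U" using op[OF U(1)] inv by simp
      finally show "ennreal (1 / r) * emeasure M (?t A) \<le> emeasure M U" .
    qed
    then have "ennreal r * (ennreal (1 / r) * emeasure M (?t A)) \<le> ennreal r * emeasure M A"
      by (rule mult_left_mono) simp
    then show "emeasure M (?t A) \<le> ennreal r * emeasure M A" using inv by simp
    show "ennreal r * emeasure M A \<le> emeasure M (?t A)"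
      unfolding M_outer[OF tA]
    proof (rule INF_greatest)
      fix U assume "U \<in> {U. open U \<and> ?t A \<subseteq> U}"
      then have U: "open U" "?t A \<subseteq> U" by auto
      let ?U = "(\<lambda>x. - g + x) ` U"
      have oU: "open ?U" using U(1) by (rule open_image_add_left)
      have "A \<subseteq> ?U" using image_mono[OF U(2), of "\<lambda>x. - g + x"] by simp
      then have "ennreal r * emeasure M A \<le> ennreal r * emeasure M ?U"
        using oU by (intro mult_left_mono M_mono) auto
      also have "\<dots> = emeasure M U" using op[OF oU] by (simp only: image_add_left_cancel)
      finally show "ennreal r * emeasure M A \<le> emeasure M U" .
    qed
  qed
  then show ?thesis using r(1) by blast
qed

lemma emeasure_V_pos_finite: "0 < emeasure M V" "emeasure M V < \<infinity>"
  using V compact_V by (auto intro!: M_open M_compact simp: open_subgroup_def simp del: infinity_ennreal_def)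

lemma modular_unique:
  assumes "r > 0" "s > 0" "ennreal r * emeasure M V = ennreal s * emeasure M V" shows "r = s"
proof -
  have "ennreal r = ennreal s"
    using assms(3) emeasure_V_pos_finite
    by (auto simp: mult.commute[of _ "emeasure M V"] ennreal_mult_cancel_left)
  then show ?thesis using assms by simp
qed

end

context td_group
begin

lemma haar_measure_SOME: "haar_measure V (SOME M. right_haar M)"
  using right_haar_radon by unfold_locales (rule someI)

lemma modular_function:
  fixes g :: 'g
  shows "modular_function g > 0"
  "A \<in> sets borel \<Longrightarrow> emeasure (SOME M. right_haar M) ((\<lambda>x. g + x) ` A) =
     ennreal (modular_function g) * emeasure (SOME M. right_haar M) A"
proof -
  interpret haar_measure V "SOME M. right_haar M" by (rule haar_measure_SOME)
  have V_borel: "V \<in> sets borel" using V by (simp add: open_subgroup_def)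
  have "\<exists>!r. r > 0 \<and> (\<forall>A\<in>sets borel. emeasure (SOME M. right_haar M) ((\<lambda>x. g + x) ` A)
                      = ennreal r * emeasure (SOME M. right_haar M) A)"
    using ex_modular[of g] modular_unique V_borel by (metis (no_types, lifting))
  from theI'[OF this]
  show "modular_function g > 0"
    "A \<in> sets borel \<Longrightarrow> emeasure (SOME M. right_haar M) ((\<lambda>x. g + x) ` A) =
       ennreal (modular_function g) * emeasure (SOME M. right_haar M) A"
    unfolding modular_function_def by blast+
qed

text \<open>The mass of \<open>V\<close> is positive and finite, so the scaling of this one set
  determines the modular function.\<close>

lemma modular_function_eqI:
  fixes g :: 'g
  assumes "r > 0"
    "emeasure (SOME M. right_haar M) ((\<lambda>x. g + x) ` V) = ennreal r * emeasure (SOME M. right_haar M) V"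
  shows "modular_function g = r"
proof -
  interpret haar_measure V "SOME M. right_haar M" by (rule haar_measure_SOME)
  have V_borel: "V \<in> sets borel" using V by (simp add: open_subgroup_def)
  show ?thesis
    using modular_function(1)[of g] modular_function(2)[OF V_borel, of g] assms by (intro modular_unique) auto
qed

lemma modular_function_0: "modular_function (0::'g) = 1"
  by (rule modular_function_eqI) auto

lemma modular_function_add: "modular_function (g + h :: 'g) = modular_function g * modular_function h"
proof (rule modular_function_eqI)
  have V_borel: "V \<in> sets borel" using V by (simp add: open_subgroup_def)
  have "(\<lambda>x. g + h + x) ` V = (\<lambda>x. g + x) ` (\<lambda>x. h + x) ` V" by (simp add: image_image add.assoc)
  then show "emeasure (SOME M. right_haar M) ((\<lambda>x. g + h + x) ` V) =
    ennreal (modular_function g * modular_function h) * emeasure (SOME M. right_haar M) V"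
    using V_borel modular_function(1)[of g] modular_function(1)[of h]
    by (simp add: modular_function(2) borel_image_add_left ennreal_mult mult.assoc)
qed (simp add: modular_function(1))

lemma modular_function_uminus: "modular_function (- g :: 'g) = inverse (modular_function g)"
  using modular_function_add[of g "- g"] modular_function(1)[of g]
  by (simp add: modular_function_0 inverse_eq_divide field_simps)

end

section \<open>Subgroups of the positive reals\<close>

lemma mult_subgroup_generated_singleton:
  assumes "x > 0" "y \<in> mult_subgroup_generated {x}" shows "\<exists>n::int. y = x powi n"
  using assms(2)
proof induction
  case (msg_gen y) then show ?case by (intro exI[of _ 1]) auto
next
  case msg_one show ?case by (intro exI[of _ 0]) auto
next
  case (msg_mult y z)
  then show ?case using assms(1) by (metis power_int_add less_irrefl)
next
  case (msg_inv y)
  then show ?case by (metis power_int_minus)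
qed

lemma mult_subgroup_generated_trivial: "S \<subseteq> {1} \<Longrightarrow> mult_subgroup_generated S = {1}"
proof -
  assume S: "S \<subseteq> {1}"
  have "y \<in> mult_subgroup_generated S \<Longrightarrow> y = 1" for y
    by (induction rule: mult_subgroup_generated.induct) (use S in auto)
  then show ?thesis using mult_subgroup_generated.msg_one by blast
qed

text \<open>Clearing denominators gives \<open>a * q ^ m = b * p ^ m\<close>. By coprimality
  \<open>p ^ m\<close> divides \<open>a\<close> and \<open>q ^ m\<close> divides
  \<open>b\<close>.\<close>

lemma coprime_ratio_power_le:
  fixes p q a b m :: nat
  assumes "p > 0" "q > 0" "coprime p q" "a > 0" "b > 0" "m > 0" "real a / real b = (real p / real q) ^ m"
  shows "p \<le> a" "q \<le> b"
proof -
  have "real (a * q ^ m) = real (b * p ^ m)"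
    using assms by (simp add: field_simps power_divide)
  then have eq: "a * q ^ m = b * p ^ m" by (simp only: of_nat_eq_iff)
  have "coprime (p ^ m) (q ^ m)" using assms by simp
  moreover have "p ^ m dvd a * q ^ m" "q ^ m dvd b * p ^ m" by (metis dvd_triv_right eq)+
  ultimately have "p ^ m dvd a" "q ^ m dvd b"
    by (simp_all add: coprime_dvd_mult_left_iff coprime_commute)
  then have "p ^ m \<le> a" "q ^ m \<le> b" using assms by (auto intro: dvd_imp_le)
  moreover have "p \<le> p ^ m" "q \<le> q ^ m" using assms by (auto intro: self_le_power)
  ultimately show "p \<le> a" "q \<le> b" by auto
qed

text \<open>A single pair already suffices. If \<open>p = q\<close>, both are 1 and any pair will
  do. Otherwise some generator differs from 1 and is a nonzero integer power of \<open>p/q\<close>;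
  a negative exponent exchanges the roles of \<open>p\<close> and \<open>q\<close>.\<close>

lemma coprime_generator_sum_le:
  fixes p q k :: nat and a b :: "nat \<Rightarrow> nat"
  assumes pq: "p > 0" "q > 0" "coprime p q" and k: "k \<ge> 1" and ab: "\<forall>i<k. a i > 0 \<and> b i > 0"
    and gen: "mult_subgroup_generated {real (a i) / real (b i) | i. i < k} = mult_subgroup_generated {real p / real q}"
  shows "p + q \<le> (\<Sum>i<k. a i + b i)"
proof -
  have "\<exists>i<k. p + q \<le> a i + b i"
  proof (cases "p = q")
    case True
    then have "p = 1" "q = 1" using pq by auto
    moreover have "0 < a 0" "0 < b 0" using k ab by auto
    ultimately show ?thesis using k by (intro exI[of _ 0]) auto
  next
    case False
    let ?S = "{real (a i) / real (b i) | i. i < k}"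
    have "real p / real q \<in> mult_subgroup_generated ?S" unfolding gen by (simp add: msg_gen)
    moreover have "real p / real q \<noteq> 1" using False pq by simp
    ultimately have "\<not> ?S \<subseteq> {1}" using mult_subgroup_generated_trivial by blast
    then obtain i where i: "i < k" "real (a i) / real (b i) \<noteq> 1" by blast
    then have "real (a i) / real (b i) \<in> mult_subgroup_generated ?S" by (blast intro: msg_gen)
    then obtain n where n: "real (a i) / real (b i) = (real p / real q) powi n"
      unfolding gen using mult_subgroup_generated_singleton[of "real p / real q"] pq by auto
    have pos: "a i > 0" "b i > 0" using ab i by auto
    have "n \<noteq> 0" using i n by auto
    then consider "n > 0" | "n < 0" by linarith
    then have "p + q \<le> a i + b i"
    proof cases
      case 1
      then have "real (a i) / real (b i) = (real p / real q) ^ nat n" using n by (simp add: power_int_def)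
      then show ?thesis using coprime_ratio_power_le[OF pq pos, of "nat n"] 1 by auto
    next
      case 2
      then have "real (a i) / real (b i) = (real q / real p) ^ nat (- n)" using n by (simp add: power_int_def)
      then show ?thesis
        using coprime_ratio_power_le[of q p "a i" "b i" "nat (- n)"] pq pos 2 by (auto simp: coprime_commute)
    qed
    then show ?thesis using i by blast
  qed
  then obtain i where "i < k" "p + q \<le> a i + b i" by blast
  moreover have "a i + b i \<le> (\<Sum>i<k. a i + b i)" if "i < k" for i
    using that by (intro member_le_sum) auto
  ultimately show ?thesis by (meson order_trans)
qed

section \<open>Suborbits of Cayley--Abels graphs\<close>

lemma card_image_cong_fibres:
  assumes "\<And>x y. x \<in> S \<Longrightarrow> y \<in> S \<Longrightarrow> f x = f y \<longleftrightarrow> g x = g y"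
  shows "card (f ` S) = card (g ` S)"
proof (rule bij_betw_same_card)
  show "bij_betw (\<lambda>c. g (inv_into S f c)) (f ` S) (g ` S)"
  proof (rule bij_betw_imageI)
    show "inj_on (\<lambda>c. g (inv_into S f c)) (f ` S)"
      using assms by (intro inj_onI) (metis f_inv_into_f inv_into_into)
    have "g (inv_into S f (f x)) = g x" if "x \<in> S" for x
      using assms that by (metis f_inv_into_f imageI inv_into_into)
    then show "(\<lambda>c. g (inv_into S f c)) ` f ` S = g ` S"
      by (simp add: image_image)
  qed
qed

lemma mult_subgroup_generated_subset:
  assumes "S \<subseteq> H" "1 \<in> H" "\<And>x y. x \<in> H \<Longrightarrow> y \<in> H \<Longrightarrow> x * y \<in> H" "\<And>x. x \<in> H \<Longrightarrow> inverse x \<in> H"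
  shows "mult_subgroup_generated S \<subseteq> H"
proof
  fix x assume "x \<in> mult_subgroup_generated S"
  then show "x \<in> H" by induction (use assms in auto)
qed

locale cayley_abels =
  fixes act :: "'g::{topological_group_add, t2_space} \<Rightarrow> 'v \<Rightarrow> 'v" and E :: "'v \<Rightarrow> 'v \<Rightarrow> bool"
  assumes td: "totally_disconnected_space TYPE('g)"
    and cayley_abels: "cayley_abels_graph act E"
begin

lemma E_sym: "E u v \<Longrightarrow> E v u"
  and E_connected: "(u, v) \<in> {(x, y). E x y}\<^sup>*"
  and finite_nbrs: "finite {w. E v w}"
  and act_0 [simp]: "act 0 v = v"
  and act_add: "act (g + h) v = act g (act h v)"
  and E_act: "E (act g u) (act g v) \<longleftrightarrow> E u v"
  and transitive: "\<exists>g. act g u = v"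
  and compact_stab: "compact {g. act g v = v}"
  and open_stab: "open {g. act g v = v}"
  using cayley_abels unfolding cayley_abels_graph_def by blast+

lemma act_minus_cancel [simp]: "act (- g) (act g v) = v" "act g (act (- g) v) = v"
  by (simp_all flip: act_add)

lemma act_eq_iff [simp]: "act g u = act g v \<longleftrightarrow> u = v"
  by (metis act_minus_cancel(1))

lemma act_minus_eq: "act g v = v \<Longrightarrow> act (- g) v = v"
  by (metis act_minus_cancel(1))

section \<open>Stabilisers, suborbits and the modular function\<close>

definition stab :: "'v \<Rightarrow> 'g set" where
  "stab v = {g. act g v = v}"

definition orb :: "'v \<Rightarrow> 'v \<Rightarrow> 'v set" where
  "orb v u = (\<lambda>x. act x u) ` stab v"

lemma open_subgroup_stab: "open_subgroup (stab v)"
  using open_stab by (simp add: open_subgroup_def stab_def act_add act_minus_eq)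

lemma td_group_stab: "td_group (stab v)"
  using td open_subgroup_stab compact_stab by unfold_locales (simp_all add: stab_def)

lemma modular_function_pos: "modular_function (g::'g) > 0"
  and modular_function_0: "modular_function (0::'g) = 1"
  and modular_function_add: "modular_function (g + h) = modular_function g * modular_function h"
  and modular_function_uminus: "modular_function (- g) = inverse (modular_function g)"
  using td_group.modular_function(1)[OF td_group_stab] td_group.modular_function_0[OF td_group_stab]
    td_group.modular_function_add[OF td_group_stab] td_group.modular_function_uminus[OF td_group_stab]
  by blast+

text \<open>The conjugate is written as a right translate of a left translate: right invariance
  removes the first, the modular function accounts for the second.\<close>

lemma stab_act: "stab (act g v) = (\<lambda>x. x + - g) ` (\<lambda>x. g + x) ` stab v"
proof -
  have "x \<in> (\<lambda>x. x + - g) ` (\<lambda>x. g + x) ` stab v" if "act x (act g v) = act g v" for x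
  proof -
    have "act (- g + x + g) v = v" using that by (simp add: act_add)
    moreover have "x = g + (- g + x + g) + - g" by (simp add: add.assoc)
    ultimately show ?thesis unfolding stab_def by blast
  qed
  then show ?thesis by (auto simp: stab_def act_add simp del: add_uminus_conv_diff)
qed

lemma card_rcos_stab: "card (rcos (stab v \<inter> stab u) ` stab v) = card (orb v u)"
proof -
  \<comment> \<open>Orbit-stabiliser for right cosets: the map constant on exactly these sends
    \<open>x\<close> to \<open>act (- x) u\<close>, and its image is still the whole orbit.\<close>
  have "(\<lambda>x. act (- x) u) ` stab v = orb v u"
    unfolding orb_def stab_def
    by (auto simp: image_iff act_minus_eq) (metis act_minus_eq minus_minus)+
  moreover have "card (rcos (stab v \<inter> stab u) ` stab v) = card ((\<lambda>x. act (- x) u) ` stab v)"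
  proof (rule card_image_cong_fibres)
    fix x y assume that: "x \<in> stab v" "y \<in> stab v"
    have "rcos (stab v \<inter> stab u) x = rcos (stab v \<inter> stab u) y \<longleftrightarrow> x - y \<in> stab v \<inter> stab u"
      by (intro rcos_eq_iff open_subgroup_Int open_subgroup_stab)
    also have "\<dots> \<longleftrightarrow> act (x + - y) u = u"
      using open_subgroup_diff[OF open_subgroup_stab that] by (simp add: stab_def)
    also have "\<dots> \<longleftrightarrow> act (- x) u = act (- y) u"
      by (metis act_add act_minus_cancel)
    finally show "rcos (stab v \<inter> stab u) x = rcos (stab v \<inter> stab u) y \<longleftrightarrow> act (- x) u = act (- y) u" .
  qed
  ultimately show ?thesis by simp
qed

lemma orb_act: "orb (act g v) v = act g ` orb v (act (- g) v)"
  unfolding orb_def stab_act by (simp add: image_image act_add del: add_uminus_conv_diff)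

text \<open>The stabilisers of \<open>v\<close> and \<open>act g v\<close> are compared through
  their intersection \<open>W\<close>, whose indices in them are orbit sizes. Conjugation by
  \<open>g\<close> scales the mass by the modular function, and \<open>act g\<close> maps the orbit
  of \<open>act (- g) v\<close> under \<open>stab v\<close> onto that of \<open>v\<close> under
  \<open>stab (act g v)\<close>.\<close>

lemma modular_function_card_orb:
  "modular_function g * card (orb v (act g v)) = card (orb v (act (- g) v))"
proof -
  let ?u = "act g v"
  define M :: "'g measure" where "M = (SOME M. right_haar M)"
  define W where "W = stab v \<inter> stab ?u"
  interpret v: haar_measure "stab v" M unfolding M_def
    by (rule td_group.haar_measure_SOME[OF td_group_stab])
  interpret u: haar_measure "stab ?u" M unfolding M_def
    by (rule td_group.haar_measure_SOME[OF td_group_stab])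
  have W: "W \<in> v.subs" "W \<in> u.subs"
    by (auto simp: v.subs_def u.subs_def W_def intro!: open_subgroup_Int open_subgroup_stab)
  have "0 < emeasure M W"
    using W(1) by (intro v.M_open) (auto simp: v.subs_def open_subgroup_def)
  moreover have "emeasure M W < \<infinity>" by (intro v.M_compact v.subs_compact W)
  ultimately obtain w where w: "emeasure M W = ennreal w" "w > 0"
    by (cases "emeasure M W") auto
  have v: "emeasure M (stab v) = ennreal (card (orb v ?u) * w)"
    using v.emeasure_V[OF W(1), of 0] card_rcos_stab[of v ?u] w
    by (simp add: W_def ennreal_mult ennreal_of_nat_eq_real_of_nat)
  have "W = stab ?u \<inter> stab v" by (auto simp: W_def)
  then have u: "emeasure M (stab ?u) = ennreal (card (orb ?u v) * w)"
    using u.emeasure_V[OF W(2), of 0] card_rcos_stab[of ?u v] w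
    by (simp add: ennreal_mult ennreal_of_nat_eq_real_of_nat)
  have borel: "stab v \<in> sets borel" using open_subgroup_stab[of v] by (simp add: open_subgroup_def)
  have "emeasure M (stab ?u) = emeasure M ((\<lambda>x. g + x) ` stab v)"
    unfolding stab_act by (intro v.M_add_right borel_image_add_left borel)
  also have "\<dots> = ennreal (modular_function g) * emeasure M (stab v)"
    unfolding M_def by (rule v.modular_function(2)[OF borel])
  finally have "card (orb ?u v) * w = modular_function g * (card (orb v ?u) * w)"
    unfolding u v using w modular_function_pos[of g] by (simp flip: ennreal_mult)
  moreover have "card (orb ?u v) = card (orb v (act (- g) v))"
    unfolding orb_act by (intro card_image) (simp add: inj_on_def)
  ultimately show ?thesis using w by simp
qed

lemma orb_self: "u \<in> orb v u"
  unfolding orb_def stab_def by (intro image_eqI[of _ _ 0]) auto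

lemma orb_eqI:
  assumes "u' \<in> orb v u" shows "orb v u' = orb v u"
proof -
  obtain x where x: "act x v = v" "u' = act x u" using assms by (auto simp: orb_def stab_def)
  have "act y u \<in> orb v u'" if "act y v = v" for y
    unfolding orb_def stab_def
    by (rule image_eqI[of _ _ "y + - x"]) (use that x act_minus_eq[OF x(1)] in \<open>simp_all add: act_add del: add_uminus_conv_diff\<close>)
  moreover have "act y u' \<in> orb v u" if "act y v = v" for y
    unfolding orb_def stab_def
    by (rule image_eqI[of _ _ "y + x"]) (use that x in \<open>simp_all add: act_add\<close>)
  ultimately show ?thesis by (auto simp: orb_def stab_def)
qed

lemma orb_nbrs: "E v u \<Longrightarrow> orb v u \<subseteq> {w. E v w}"
  unfolding orb_def stab_def using E_act by (auto) metis

text \<open>If \<open>x\<close> fixes \<open>v\<close> and sends \<open>act g v\<close> to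
  \<open>act h v\<close>, then \<open>- h + x + g\<close> fixes \<open>v\<close> and sends
  \<open>act (- g) v\<close> to \<open>act (- h) v\<close>.\<close>

lemma orb_reverse_cong:
  assumes "orb v (act g v) = orb v (act h v)"
  shows "orb v (act (- g) v) = orb v (act (- h) v)"
proof -
  obtain x where x: "act x v = v" "act h v = act x (act g v)"
    using assms orb_self[of "act h v" v] by (auto simp: orb_def stab_def)
  have 1: "act (- h + x + g) v = v" using x(2) by (simp add: act_add) (metis act_minus_cancel(1))
  have "act (- h) v = act (- h + x + g) (act (- g) v)"
    using x(1) by (simp add: act_add)
  then have "act (- h) v \<in> orb v (act (- g) v)" using 1 unfolding orb_def stab_def by blast
  then show ?thesis using orb_eqI by metis
qed

text \<open>The paired suborbit: the orbit of \<open>g v\<close> is sent to the orbit of \<open>g\<^sup>-\<^sup>1 v\<close>.\<close>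

definition reverse :: "'v \<Rightarrow> 'v set \<Rightarrow> 'v set" where
  "reverse v c = orb v (act (- (SOME g. c = orb v (act g v))) v)"

lemma reverse_orb: "reverse v (orb v (act g v)) = orb v (act (- g) v)"
proof -
  let ?h = "SOME h. orb v (act g v) = orb v (act h v)"
  have "orb v (act g v) = orb v (act ?h v)"
    by (rule someI[of "\<lambda>h. orb v (act g v) = orb v (act h v)"]) simp
  then show ?thesis unfolding reverse_def by (metis orb_reverse_cong)
qed

section \<open>Suborbits on the neighbours of a vertex\<close>

definition orbits :: "'v \<Rightarrow> 'v set set" where
  "orbits v = orb v ` {w. E v w}"

lemma orbitsE:
  assumes "c \<in> orbits v" obtains g where "c = orb v (act g v)" "E v (act g v)"
  using assms transitive[of v] unfolding orbits_def by (metis (mono_tags, lifting) imageE mem_Collect_eq)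

lemma orb_in_orbits: "E v (act g v) \<Longrightarrow> orb v (act g v) \<in> orbits v"
  by (simp add: orbits_def)

lemma E_reverse: "E v (act g v) \<Longrightarrow> E v (act (- g) v)"
  by (metis E_act E_sym act_minus_cancel(1))

lemma reverse_in_orbits: "c \<in> orbits v \<Longrightarrow> reverse v c \<in> orbits v"
  by (metis E_reverse orb_in_orbits orbitsE reverse_orb)

lemma reverse_reverse: "c \<in> orbits v \<Longrightarrow> reverse v (reverse v c) = c"
  by (metis minus_minus orbitsE reverse_orb)

lemma finite_orbits: "finite (orbits v)"
  by (simp add: orbits_def finite_nbrs)

lemma finite_orbit: "c \<in> orbits v \<Longrightarrow> finite c"
  unfolding orbits_def using orb_nbrs finite_nbrs finite_subset by blast

lemma orbit_card_pos: "c \<in> orbits v \<Longrightarrow> card c > 0"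
  by (metis card_gt_0_iff empty_iff finite_orbit imageE orb_self orbits_def)

lemma sum_card_orbits: "(\<Sum>c\<in>orbits v. card c) = card {w. E v w}"
proof -
  have "\<Union>(orbits v) = {w. E v w}"
    unfolding orbits_def using orb_nbrs orb_self by blast
  moreover have "card (\<Union>(orbits v)) = (\<Sum>c\<in>orbits v. card c)"
  proof (rule card_Union_disjoint)
    show "pairwise disjnt (orbits v)"
      unfolding pairwise_def disjnt_iff orbits_def using orb_eqI by blast
  qed (rule finite_orbit)
  ultimately show ?thesis by simp
qed

text \<open>Orbits as large as their reverse have modular value 1 and are not needed as generators.
  Keeping only orbits strictly smaller than their reverse picks one orbit from each remaining pair.\<close>

definition growing :: "'v \<Rightarrow> 'v set set" where
  "growing v = {c \<in> orbits v. card c < card (reverse v c)}"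

text \<open>\<open>reverse\<close> is an involution on \<open>orbits v\<close> and sends growing
  orbits to orbits larger than their reverse, which are not growing. All orbits in the sum are
  therefore distinct.\<close>

lemma sum_growing_le:
  "(\<Sum>c\<in>growing v. card (reverse v c) + card c) \<le> card {w. E v w}"
proof -
  have sub: "growing v \<subseteq> orbits v" "reverse v ` growing v \<subseteq> orbits v"
    using reverse_in_orbits by (auto simp: growing_def)
  have fin: "finite (growing v)" using finite_subset[OF sub(1) finite_orbits] .
  have inj: "inj_on (reverse v) (growing v)"
    using sub(1) by (intro inj_onI) (metis reverse_reverse subsetD)
  have disj: "growing v \<inter> reverse v ` growing v = {}"
    using reverse_reverse by (fastforce simp: growing_def)
  have "(\<Sum>c\<in>growing v. card (reverse v c) + card c) =
      (\<Sum>c\<in>reverse v ` growing v. card c) + (\<Sum>c\<in>growing v. card c)"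
    by (simp add: sum.distrib sum.reindex[OF inj])
  also have "\<dots> = (\<Sum>c\<in>growing v \<union> reverse v ` growing v. card c)"
    using fin disj by (simp add: sum.union_disjoint)
  also have "\<dots> \<le> (\<Sum>c\<in>orbits v. card c)"
    using sub by (intro sum_mono2 finite_orbits) auto
  finally show ?thesis by (simp add: sum_card_orbits)
qed

lemma modular_function_orbit:
  assumes "E v (act g v)"
  shows "modular_function g = card (reverse v (orb v (act g v))) / card (orb v (act g v))"
  using modular_function_card_orb[of g v] orbit_card_pos[OF orb_in_orbits[OF assms]]
  by (simp add: reverse_orb field_simps)

text \<open>A group element is a product of elements moving \<open>v\<close> to a neighbour and one
  fixing \<open>v\<close>, as seen along a path in the graph. The modular value of such a factor is
  1, a listed quotient or the inverse of one.\<close>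

lemma range_modular_function:
  "range (modular_function :: 'g \<Rightarrow> real) =
     mult_subgroup_generated ((\<lambda>c. card (reverse v c) / card c) ` growing v)" (is "_ = ?D")
proof
  show "?D \<subseteq> range (modular_function :: 'g \<Rightarrow> real)"
  proof (rule mult_subgroup_generated_subset)
    show "(\<lambda>c. card (reverse v c) / card c) ` growing v \<subseteq> range (modular_function :: 'g \<Rightarrow> real)"
    proof (rule image_subsetI)
      fix c assume "c \<in> growing v"
      then obtain g where "c = orb v (act g v)" "E v (act g v)"
        unfolding growing_def by (auto elim: orbitsE)
      then show "card (reverse v c) / card c \<in> range (modular_function :: 'g \<Rightarrow> real)"
        using modular_function_orbit by (metis rangeI)
    qed
  next
    show "1 \<in> range (modular_function :: 'g \<Rightarrow> real)" by (metis modular_function_0 rangeI)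
    show "x * y \<in> range (modular_function :: 'g \<Rightarrow> real)"
      if "x \<in> range (modular_function :: 'g \<Rightarrow> real)" "y \<in> range (modular_function :: 'g \<Rightarrow> real)" for x y
      using that by (auto simp flip: modular_function_add)
    show "inverse x \<in> range (modular_function :: 'g \<Rightarrow> real)"
      if "x \<in> range (modular_function :: 'g \<Rightarrow> real)" for x
      using that by (auto simp flip: modular_function_uminus)
  qed
next
  have nbr: "modular_function g \<in> ?D" if g: "E v (act g v)" for g
  proof -
    let ?c = "orb v (act g v)"
    have c: "?c \<in> orbits v" using g by (rule orb_in_orbits)
    consider "?c \<in> growing v" | "reverse v ?c \<in> growing v" | "card (reverse v ?c) = card ?c"
      using c reverse_in_orbits[OF c] reverse_reverse[OF c] by (auto simp: growing_def) linarith
    then show ?thesis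
    proof cases
      case 1 then show ?thesis unfolding modular_function_orbit[OF g] by (intro msg_gen imageI)
    next
      case 2
      then have "inverse (card (reverse v (reverse v ?c)) / card (reverse v ?c)) \<in> ?D"
        by (intro msg_inv msg_gen imageI)
      then show ?thesis unfolding modular_function_orbit[OF g] by (simp add: reverse_reverse[OF c])
    next
      case 3
      then show ?thesis unfolding modular_function_orbit[OF g] using orbit_card_pos[OF c] by (simp add: msg_one)
    qed
  qed
  \<comment> \<open>Induction along a path from \<open>v\<close> to \<open>u\<close>. At the start
    the orbits are singletons and the value is 1; in the step \<open>g = h + (- h + g)\<close>,
    where \<open>- h + g\<close> moves \<open>v\<close> to a neighbour.\<close>
  have "\<forall>g. act g v = u \<longrightarrow> modular_function g \<in> ?D" for u
    using E_connected[of v u]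
  proof induction
    case base
    show ?case
    proof (intro allI impI)
      fix g assume "act g v = v"
      then have "orb v (act g v) = {v}" "orb v (act (- g) v) = {v}"
        using act_minus_eq[of g v] by (auto simp: orb_def stab_def intro!: image_eqI[of _ _ 0])
      then show "modular_function g \<in> ?D"
        using modular_function_card_orb[of g v] by (simp add: msg_one)
    qed
  next
    case (step u w)
    show ?case
    proof (intro allI impI)
      fix g assume g: "act g v = w"
      obtain h where h: "act h v = u" using transitive by blast
      have "E u w" using step by simp
      then have "E v (act (- h + g) v)"
        unfolding act_add g using E_act[of "- h" u w] h by (metis act_minus_cancel(1))
      then have "modular_function (- h + g) \<in> ?D" by (rule nbr)
      moreover have "modular_function h \<in> ?D" using step h by blast
      ultimately have "modular_function (h + (- h + g)) \<in> ?D"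
        unfolding modular_function_add[of h "- h + g"] by (intro msg_mult)
      then show "modular_function g \<in> ?D" by (simp flip: add.assoc)
    qed
  qed
  then show "range (modular_function :: 'g \<Rightarrow> real) \<subseteq> ?D" by blast
qed

section \<open>Lower bounds for the degree\<close>

lemma card_nbrs_act: "card {w. E (act g v) w} = card {w. E v w}"
proof -
  have "{w. E (act g v) w} = act g ` {w. E v w}"
  proof (intro set_eqI iffI)
    fix w assume "w \<in> {w. E (act g v) w}"
    then have "E v (act (- g) w)" using E_act[of "- g" "act g v" w] by simp
    then show "w \<in> act g ` {w. E v w}" by (intro image_eqI[of _ _ "act (- g) w"]) auto
  qed (auto simp: E_act)
  then show ?thesis by (simp add: card_image inj_on_def)
qed

text \<open>With all degrees at most 1 a connected graph consists of \<open>v\<close> and its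
  neighbours, hence is finite. The group would then be a finite union of translates of the compact
  stabiliser.\<close>

lemma degree_ge_2:
  assumes "\<not> compact (UNIV :: 'g set)" shows "card {w. E v w} \<ge> 2"
proof (rule ccontr)
  assume "\<not> card {w. E v w} \<ge> 2"
  then have deg: "card {w. E u w} \<le> 1" for u
    using card_nbrs_act[of _ v] transitive[of v u] by (metis not_less_eq_eq numeral_2_eq_2 One_nat_def)
  have uniq: "x = y" if "E u x" "E u y" for u x y
    using deg[of u] finite_nbrs[of u] that by (auto simp: card_le_Suc0_iff_eq)
  have "u \<in> insert v {w. E v w}" for u
    using E_connected[of v u]
  proof induction
    case (step x y)
    then show ?case using uniq E_sym by blast
  qed simp
  then have fin: "finite (UNIV :: 'v set)"
    using finite_nbrs[of v] by (metis UNIV_eq_I finite_insert)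
  have "compact {g. act g v = u}" for u
  proof -
    obtain h where h: "act h v = u" using transitive by blast
    have hu: "act (- h) u = v" using h by auto
    have "x \<in> (\<lambda>x. h + x) ` stab v" if "act x v = u" for x
      by (rule image_eqI[of _ _ "- h + x"]) (use that hu in \<open>simp_all add: stab_def act_add flip: add.assoc\<close>)
    then have "{g. act g v = u} = (\<lambda>x. h + x) ` stab v"
      using h by (auto simp: stab_def act_add)
    then show ?thesis
      using compact_stab by (simp add: stab_def compact_continuous_image continuous_on_add_left)
  qed
  moreover have "(UNIV :: 'g set) = (\<Union>u. {g. act g v = u})" by auto
  ultimately show False using assms fin by (metis compact_UN)
qed

lemma ex_generators_le_degree:
  assumes "\<not> compact (UNIV :: 'g set)"
  shows "\<exists>(k::nat) (p::nat \<Rightarrow> nat) (q::nat \<Rightarrow> nat). k \<ge> 1 \<and> (\<forall>i<k. p i > 0 \<and> q i > 0) \<and>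
    mult_subgroup_generated {real (p i) / real (q i) | i. i < k} = range (modular_function :: 'g \<Rightarrow> real) \<and>
    (\<Sum>i<k. p i + q i) \<le> card {w. E v w}"
proof (cases "growing v = {}")
  case True
  then have "range (modular_function :: 'g \<Rightarrow> real) = {1}"
    by (simp add: range_modular_function[of v] mult_subgroup_generated_trivial)
  moreover have "mult_subgroup_generated {real 1 / real 1 |i. i < (1::nat)} = {1}"
    by (rule mult_subgroup_generated_trivial) auto
  \<comment> \<open>The trivial group is generated by the single quotient 1/1, whose contribution 2
    is covered by \<open>degree_ge_2\<close>.\<close>
  ultimately show ?thesis
    using degree_ge_2[OF assms, of v]
    by (intro exI[of _ "1::nat"] exI[of _ "\<lambda>_::nat. 1::nat"]) simp
next
  case False
  have fin: "finite (growing v)" using finite_orbits[of v] by (simp add: growing_def)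
  define k where "k = card (growing v)"
  obtain f where f: "bij_betw f {..<k} (growing v)"
    unfolding k_def using fin ex_bij_betw_nat_finite by (metis atLeast0LessThan)
  have im: "f ` {..<k} = growing v" using f by (simp add: bij_betw_def)
  have set: "{real (card (reverse v (f i))) / real (card (f i)) | i. i < k} =
      (\<lambda>c. card (reverse v c) / card c) ` growing v"
    unfolding im[symmetric] by auto
  have orb: "f i \<in> orbits v" if "i < k" for i using im that by (auto simp: growing_def)
  have "(\<Sum>i<k. card (reverse v (f i)) + card (f i)) = (\<Sum>c\<in>growing v. card (reverse v c) + card c)"
    by (rule sum.reindex_bij_betw[OF f])
  then have "(\<Sum>i<k. card (reverse v (f i)) + card (f i)) \<le> card {w. E v w}"
    using sum_growing_le by simp
  moreover have "k \<ge> 1" unfolding k_def using False fin by (simp add: Suc_leI card_gt_0_iff)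
  moreover have "\<forall>i<k. card (reverse v (f i)) > 0 \<and> card (f i) > 0"
    using orb orbit_card_pos reverse_in_orbits by blast
  ultimately show ?thesis
    unfolding range_modular_function[of v] set[symmetric]
    by (intro exI[of _ k] exI[of _ "\<lambda>i. card (reverse v (f i))"] exI[of _ "\<lambda>i. card (f i)"] conjI) auto
qed

end

theorem theorem4p4:
  fixes act :: "'g::{topological_group_add, t2_space} \<Rightarrow> 'v \<Rightarrow> 'v"
    and E :: "'v \<Rightarrow> 'v \<Rightarrow> bool"
    and H :: "real set" and A :: "nat set"
  assumes "\<not> compact (UNIV :: 'g set)"
    and "compactly_generated TYPE('g)"
    and "totally_disconnected_space TYPE('g)"
    and "locally_compact_type TYPE('g)"
    and H_def: "H = range (modular_function :: 'g \<Rightarrow> real)"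
    and A_def: "A = {(\<Sum>i<k. p i + q i) | (k::nat) (p::nat \<Rightarrow> nat) (q::nat \<Rightarrow> nat). k \<ge> 1 \<and> (\<forall>i<k. p i > 0 \<and> q i > 0) \<and>
                   mult_subgroup_generated {real (p i) / real (q i) | i. i < k} = H}"
    and "cayley_abels_graph act E"
  shows "A \<noteq> {} \<and> (\<forall>v. (LEAST a. a \<in> A) \<le> card {w. E v w})
     \<and> (\<forall>p q :: nat. p > 0 \<and> q > 0 \<and> coprime p q \<and>
           H = mult_subgroup_generated {real p / real q}
           \<longrightarrow> (\<forall>v. p + q \<le> card {w. E v w}))"
proof -
  interpret cayley_abels act E using assms(3,7) by unfold_locales
  have ex: "\<exists>a\<in>A. a \<le> card {w. E v w}" for v
    using ex_generators_le_degree[OF assms(1), of v] unfolding A_def H_def by blast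
  \<comment> \<open>The cyclic bound holds for every element of \<open>A\<close>, so it can be
    applied to the one found below the degree.\<close>
  have cyclic: "p + q \<le> a"
    if "a \<in> A" "p > 0" "q > 0" "coprime p q" "H = mult_subgroup_generated {real p / real q}" for a p q
    using that coprime_generator_sum_le[of p q] unfolding A_def by auto
  show ?thesis
  proof (intro conjI allI impI)
    show "A \<noteq> {}" using ex by blast
    fix v
    obtain a where a: "a \<in> A" "a \<le> card {w. E v w}" using ex by blast
    show "(LEAST a. a \<in> A) \<le> card {w. E v w}" using Least_le[of "\<lambda>a. a \<in> A" a] a by linarith
    fix p q :: nat
    assume "p > 0 \<and> q > 0 \<and> coprime p q \<and> H = mult_subgroup_generated {real p / real q}"
    then show "p + q \<le> card {w. E v w}" using cyclic[OF a(1), of p q] a(2) by auto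
  qed
qed

end
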